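(* Let $1<q<\infty$. If $J_1$ and $J_2$ are non-constant inner functions not vanishing at the origin, then the following strict inequality holds: $$\sup_{g\in H^q,\ \|g\|_q\le 1}\left|\frac1{2\pi i}\int_{\mathbb{T}} g(\zeta)\,\overline{J_1(\zeta)}\,d\zeta\right|<\sup_{g\in H^q,\ \|g\|_q\le 1}\left|\frac1{2\pi i}\int_{\mathbb{T}} g(\zeta)\,\overline{J_1(\zeta)J_2(\zeta)}\,d\zeta\right|.$$
   Context: $\mathbb{T}$ is the unit circle, positively oriented. $H^q$ is the Hardy space of analytic functions on the open unit disk with norm $\|g\|_q^q=\sup_{0<r<1}\frac1{2\pi}\int_0^{2\pi}|g(re^{i\theta})|^q\,d\theta$; functions in $H^q$ are identified with their boundary values on $\mathbb{T}$. A function in $H^\infty$ is inner if its boundary values have modulus $1$ a.e. on $\mathbb{T}$. *)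

theory Defs
  imports "HOL-Complex_Analysis.Complex_Analysis"
begin

definition circle_mean :: "real \<Rightarrow> (complex \<Rightarrow> complex) \<Rightarrow> real \<Rightarrow> real" where
  "circle_mean q g r =
     1 / (2 * pi) * integral {0..2 * pi} (\<lambda>\<theta>. norm (g (of_real r * cis \<theta>)) powr q)"

definition hardy_space :: "real \<Rightarrow> (complex \<Rightarrow> complex) set" where
  "hardy_space q =
     {g. g holomorphic_on ball 0 1 \<and> bdd_above (circle_mean q g ` {0<..<1})}"

text \<open>The value is meaningful only for members of \<^term>\<open>hardy_space q\<close>, as otherwise the
  supremum is taken over an unbounded set of reals.\<close>

definition hardy_norm :: "real \<Rightarrow> (complex \<Rightarrow> complex) \<Rightarrow> real" where
  "hardy_norm q g = (SUP r\<in>{0<..<1}. circle_mean q g r) powr (1 / q)"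

definition hardy_space_inf :: "(complex \<Rightarrow> complex) set" where
  "hardy_space_inf = {g. g holomorphic_on ball 0 1 \<and> bounded (g ` ball 0 1)}"

text \<open>The boundary values are the radial limits. By Fatou's theorem these exist almost
  everywhere on the unit circle for all functions in the Hardy spaces considered here; where
  the limit does not exist, \<^const>\<open>Lim\<close> returns one fixed unspecified complex number.\<close>

definition boundary_value :: "(complex \<Rightarrow> complex) \<Rightarrow> complex \<Rightarrow> complex" where
  "boundary_value g \<zeta> = Lim (at_left 1) (\<lambda>r::real. g (of_real r * \<zeta>))"

definition inner_function :: "(complex \<Rightarrow> complex) \<Rightarrow> bool" where
  "inner_function J \<longleftrightarrow> J \<in> hardy_space_inf \<and>
     (AE \<theta> in lebesgue_on {0..2 * pi}. norm (boundary_value J (cis \<theta>)) = 1)"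

end

theory Submission imports Defs begin

text \<open>The supremum attached to a single inner function J with c = J(0) and |c| < 1 can be computed.
Let p be the exponent conjugate to q. Then the supremum is (1 - |c|^2)^(1/p), and it is a maximum.
The theorem follows at once: passing from J1 to J1 J2 replaces |J1(0)| by |J1(0)| |J2(0)|, which is
strictly smaller because J1(0) is not 0 and the nonconstant J2 satisfies |J2(0)| < 1.

To see where the value comes from, put k = 1 - cnj c * J. The power k^(2/p) is 1 + J \<psi>(J) for
some analytic \<psi>. On the circle cnj J = 1/J, so cnj J = cnj J * k^(2/p) - \<psi>(J), and the last term
does not contribute to the pairing with g because z g(z) \<psi>(J(z)) is analytic and vanishes at 0.
Hoelder's inequality therefore bounds the pairing by the L^p norm of k^(2/p), and the p-th power of
its modulus is |k|^2, whose mean over the circle is 1 - |c|^2. This is \<open>pairing_upper_bound\<close>.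
Conversely b = (J - c)/k maps the disc to itself and vanishes at 0, so |b(z)/z| \<le> 1 by the
Schwarz lemma, and g(z) = (b(z)/z) k(z)^(2/q), divided by (1 - |c|^2)^(1/q), lies in the unit ball
of H^q and gives equality. This is \<open>pairing_attained\<close>.

Both computations take place on the boundary and rest on Fatou's theorem. For a bounded analytic f
(\<open>Fatou_bounded\<close>) the Parseval identity makes the dilations of f Cauchy in the mean, so that f
converges almost everywhere to some h along a sequence of circles. A primitive F of f is continuous
on the closed disc, and its increments along the unit circle are integrals of h. By the Lebesgue
differentiation theorem F is differentiable along the circle at almost every point, and the maximum
modulus principle turns this tangential derivative into a radial limit of F' = f. A function with
bounded means over circles (\<open>Fatou_L1_means\<close>) is a quotient of two bounded functions. The
denominator is a locally uniform limit of reciprocals of functions 1 + S, where the real part of S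
is the Poisson integral of the modulus of a dilation. Integrals over inner circles pass
to the limit by \<open>integral_limit_of_Lq_bounded\<close>, for which q > 1 is essential.\<close>

section \<open>Passing to the limit under a bound on q-th power means\<close>

lemma le_one_plus_powr:
  fixes t q :: real
  assumes "1 \<le> q" "0 \<le> t"
  shows "t \<le> 1 + t powr q"
proof (cases "t \<le> 1")
  case False
  then have "t powr 1 \<le> t powr q" using assms by (intro powr_mono) auto
  then show ?thesis using False by simp
qed (use assms in \<open>auto intro: add_increasing2\<close>)

text \<open>A bound on the q-th power means with q > 1 makes the sequence uniformly integrable, so almost
everywhere convergence suffices for convergence of the integrals. Fatou's lemma transfers the bound
to the limit. The difference t = |X n - Y| is then split as t \<le> min t K + K^(1-q) t^q: the first
part converges by dominated convergence, and the second is small in the mean for large K.\<close>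

lemma integral_limit_of_Lq_bounded:
  fixes X :: "nat \<Rightarrow> 'a \<Rightarrow> complex" and Y :: "'a \<Rightarrow> complex"
  assumes fin: "finite_measure M" and q: "1 < q"
    and [measurable]: "\<And>n. X n \<in> borel_measurable M" "Y \<in> borel_measurable M"
    and int: "\<And>n. integrable M (\<lambda>x. norm (X n x) powr q)"
    and bd: "\<And>n. (LINT x|M. norm (X n x) powr q) \<le> B"
    and lim: "AE x in M. (\<lambda>n. X n x) \<longlonglongrightarrow> Y x"
  shows "integrable M (\<lambda>x. norm (Y x) powr q)" (is ?A)
    and "(LINT x|M. norm (Y x) powr q) \<le> B" (is ?B)
    and "integrable M Y" (is ?C)
    and "(\<lambda>n. LINT x|M. X n x) \<longlonglongrightarrow> (LINT x|M. Y x)" (is ?D)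
proof -
  interpret finite_measure M by fact
  have B0: "0 \<le> B"
  proof -
    have "0 \<le> (LINT x|M. norm (X 0 x) powr q)" by (intro integral_nonneg_AE) simp
    then show ?thesis using bd[of 0] by linarith
  qed
  have le: "t \<le> 1 + t powr q" if "0 \<le> t" for t :: real
    using q that by (intro le_one_plus_powr) auto
  have "(\<integral>\<^sup>+x. ennreal (norm (Y x) powr q) \<partial>M) = (\<integral>\<^sup>+x. liminf (\<lambda>n. ennreal (norm (X n x) powr q)) \<partial>M)"
  proof (rule nn_integral_cong_AE, use lim in eventually_elim)
    case (elim x)
    then have "(\<lambda>n. ennreal (norm (X n x) powr q)) \<longlonglongrightarrow> ennreal (norm (Y x) powr q)"
      using q by (intro tendsto_ennrealI tendsto_powr' tendsto_norm) auto
    then show ?case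
      by (intro lim_imp_Liminf[symmetric]) auto
  qed
  also have "\<dots> \<le> liminf (\<lambda>n. \<integral>\<^sup>+x. ennreal (norm (X n x) powr q) \<partial>M)"
    by (rule nn_integral_liminf) measurable
  also have "\<dots> \<le> ennreal B"
  proof -
    have "(\<integral>\<^sup>+x. ennreal (norm (X n x) powr q) \<partial>M) \<le> ennreal B" for n
      using int bd by (subst nn_integral_eq_integral) (auto intro: ennreal_leI)
    then show ?thesis
      by (intro Liminf_le) (auto)
  qed
  finally have fin: "(\<integral>\<^sup>+x. ennreal (norm (Y x) powr q) \<partial>M) \<le> ennreal B" .
  show A: ?A
  proof (rule integrableI_nonneg)
    show "(\<integral>\<^sup>+x. ennreal (norm (Y x) powr q) \<partial>M) < \<infinity>"
      using fin by (rule order.strict_trans1) simp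
  qed auto
  show Bb: ?B
  proof -
    have "ennreal (LINT x|M. norm (Y x) powr q) \<le> ennreal B"
      using fin nn_integral_eq_integral[OF A] by simp
    then show ?thesis using B0 by simp
  qed
  show C: ?C
    by (rule Bochner_Integration.integrable_bound[of _ "\<lambda>x. 1 + norm (Y x) powr q"])
       (use A in \<open>auto intro!: le\<close>)
  have intX: "integrable M (X n)" for n
    by (rule Bochner_Integration.integrable_bound[of _ "\<lambda>x. 1 + norm (X n x) powr q"])
       (use int in \<open>auto intro!: le\<close>)
  have "(\<lambda>n. LINT x|M. norm (X n x - Y x)) \<longlonglongrightarrow> 0"
  proof (rule LIMSEQ_I)
    fix e :: real assume "0 < e"
    define D where "D = 2 powr q * (2 * B) + 1"
    have D: "D > 0" using B0 by (simp add: D_def add_nonneg_pos)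
    \<comment> \<open>K is chosen so that K powr (1 - q) times the bound D on the q-th power means equals e / 2.\<close>
    define K where "K = (e / (2 * D)) powr (1 / (1 - q))"
    have K: "K > 0" using \<open>0 < e\<close> D by (simp add: K_def)
    have Kq: "K powr (1 - q) = e / (2 * D)"
      using q \<open>0 < e\<close> D by (simp add: K_def powr_powr)
    have trunc: "t \<le> min t K + K powr (1 - q) * t powr q" if "0 \<le> t" for t
    proof (cases "t \<le> K")
      case False
      have "t = t powr (1 - q) * t powr q"
        using False K by (simp flip: powr_add)
      also have "\<dots> \<le> K powr (1 - q) * t powr q"
        using False K q by (intro mult_right_mono powr_mono2') auto
      finally show ?thesis using False K by (simp add: min_def)
    qed auto
    have qsum: "norm (X n x - Y x) powr q \<le> 2 powr q * (norm (X n x) powr q + norm (Y x) powr q)" for n x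
    proof -
      have "norm (X n x - Y x) \<le> 2 * max (norm (X n x)) (norm (Y x))"
        using norm_triangle_ineq4[of "X n x" "Y x"] by (auto simp: max_def)
      then have "norm (X n x - Y x) powr q \<le> (2 * max (norm (X n x)) (norm (Y x))) powr q"
        using q by (intro powr_mono2) auto
      also have "\<dots> = 2 powr q * max (norm (X n x)) (norm (Y x)) powr q"
        by (simp add: powr_mult)
      also have "max (norm (X n x)) (norm (Y x)) powr q \<le> norm (X n x) powr q + norm (Y x) powr q"
        by (auto simp: max_def)
      finally show ?thesis by simp
    qed
    have intd: "integrable M (\<lambda>x. norm (X n x - Y x) powr q)" for n
      by (rule Bochner_Integration.integrable_bound[of _ "\<lambda>x. 2 powr q * (norm (X n x) powr q + norm (Y x) powr q)"])
         (use int A in \<open>auto intro!: order_trans[OF qsum]\<close>)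
    have bdd: "(LINT x|M. norm (X n x - Y x) powr q) \<le> D" for n
    proof -
      have "(LINT x|M. norm (X n x - Y x) powr q) \<le> (LINT x|M. 2 powr q * (norm (X n x) powr q + norm (Y x) powr q))"
        by (intro integral_mono intd qsum) (use int A in auto)
      also have "\<dots> = 2 powr q * ((LINT x|M. norm (X n x) powr q) + (LINT x|M. norm (Y x) powr q))"
        using int A by simp
      also have "\<dots> \<le> 2 powr q * (B + B)"
        using bd Bb by (intro mult_left_mono add_mono) auto
      finally show ?thesis by (simp add: D_def)
    qed
    have intm: "integrable M (\<lambda>x. min (norm (X n x - Y x)) K)" for n
      by (rule integrable_const_bound[where B = K]) (use K in auto)
    have "(\<lambda>n. LINT x|M. min (norm (X n x - Y x)) K) \<longlonglongrightarrow> (LINT x|M. (0::real))"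
    proof (rule integral_dominated_convergence[where w = "\<lambda>_. K"])
      show "AE x in M. (\<lambda>n. min (norm (X n x - Y x)) K) \<longlonglongrightarrow> 0"
        using lim
      proof eventually_elim
        case (elim x)
        then have "(\<lambda>n. min (norm (X n x - Y x)) K) \<longlonglongrightarrow> min (norm (Y x - Y x)) K"
          by (intro tendsto_intros)
        then show ?case using K by simp
      qed
    qed (use K in auto)
    then have "\<forall>\<^sub>F n in sequentially. (LINT x|M. min (norm (X n x - Y x)) K) < e / 2"
      using \<open>0 < e\<close> by (intro order_tendstoD) auto
    then obtain N where N: "\<And>n. n \<ge> N \<Longrightarrow> (LINT x|M. min (norm (X n x - Y x)) K) < e / 2"
      by (auto simp: eventually_sequentially)
    have "norm ((LINT x|M. norm (X n x - Y x)) - 0) < e" if "n \<ge> N" for n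
    proof -
      have "(LINT x|M. norm (X n x - Y x))
          \<le> (LINT x|M. min (norm (X n x - Y x)) K + K powr (1 - q) * norm (X n x - Y x) powr q)"
        by (intro integral_mono trunc) (use intX C intm intd in auto)
      also have "\<dots> = (LINT x|M. min (norm (X n x - Y x)) K) + K powr (1 - q) * (LINT x|M. norm (X n x - Y x) powr q)"
        using intm intd by simp
      also have "\<dots> < e / 2 + K powr (1 - q) * D"
        using N[OF that] bdd by (intro add_less_le_mono mult_left_mono) auto
      also have "\<dots> = e" using Kq D by simp
      finally show ?thesis by simp
    qed
    then show "\<exists>N. \<forall>n\<ge>N. norm ((LINT x|M. norm (X n x - Y x)) - 0) < e" by blast
  qed
  then have "(\<lambda>n. ennreal (LINT x|M. norm (X n x - Y x))) \<longlonglongrightarrow> ennreal 0"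
    by (rule tendsto_ennrealI)
  moreover have "ennreal (LINT x|M. norm (X n x - Y x)) = (\<integral>\<^sup>+x. norm (X n x - Y x) \<partial>M)" for n
    by (rule nn_integral_eq_integral[symmetric]) (use intX C in auto)
  ultimately show ?D
    by (intro tendsto_L1_int intX C) simp
qed

section \<open>Means over circles, the Poisson kernel and Parseval\<close>

abbreviation circ :: "real measure" where
  "circ \<equiv> lebesgue_on {0..2 * pi}"

lemma finite_measure_circ: "finite_measure circ"
  by (rule finite_measure_lebesgue_on) simp

lemma measure_circ: "measure circ (space circ) = 2 * pi"
  by (simp add: measure_restrict_space)

lemma integrable_circ_continuous:
  fixes f :: "real \<Rightarrow> 'a::euclidean_space"
  shows "continuous_on {0..2 * pi} f \<Longrightarrow> integrable circ f"
  by (rule continuous_imp_integrable_real)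

lemma continuous_on_circle:
  assumes "continuous_on (cball 0 1) f"
  shows "continuous_on A (\<lambda>\<theta>. f (cis \<theta>))"
  by (rule continuous_on_compose2[OF assms]) (auto intro!: continuous_intros)

lemma contour_integral_unit_circle:
  assumes "integrable circ (\<lambda>\<theta>. f (cis \<theta>) * cis \<theta>)"
  shows "contour_integral (circlepath 0 1) f = \<i> * (LINT \<theta>|circ. f (cis \<theta>) * cis \<theta>)"
proof -
  have "contour_integral (circlepath 0 1) f = integral {0..2*pi} (\<lambda>t. f (0 + complex_of_real 1 * cis t) * complex_of_real 1 * \<i> * cis t)"
    unfolding circlepath_def by (rule contour_integral_part_circlepath_eq) auto
  also have "\<dots> = integral {0..2*pi} (\<lambda>t. \<i> * (f (cis t) * cis t))"
    by (simp add: mult_ac)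
  also have "\<dots> = (LINT t|circ. \<i> * (f (cis t) * cis t))"
    using assms by (intro lebesgue_integral_eq_integral[symmetric] integrable_mult_right) auto
  finally show ?thesis by simp
qed

lemma Cauchy_mean:
  fixes f :: "complex \<Rightarrow> complex"
  assumes "continuous_on (cball 0 1) f" "f holomorphic_on ball 0 1" and z: "norm z < 1"
  shows "(LINT \<theta>|circ. f (cis \<theta>) * cis \<theta> / (cis \<theta> - z)) = 2 * pi * f z"
proof -
  have "cis \<theta> \<noteq> z" for \<theta>
    using z by (metis norm_cis less_irrefl)
  then have "continuous_on {0..2*pi} (\<lambda>\<theta>. f (cis \<theta>) / (cis \<theta> - z) * cis \<theta>)"
    by (intro continuous_intros continuous_on_circle assms) auto
  then have "contour_integral (circlepath 0 1) (\<lambda>u. f u / (u - z)) =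
      \<i> * (LINT \<theta>|circ. f (cis \<theta>) / (cis \<theta> - z) * cis \<theta>)"
    by (intro contour_integral_unit_circle integrable_circ_continuous)
  moreover have "contour_integral (circlepath 0 1) (\<lambda>u. f u / (u - z)) = 2 * of_real pi * \<i> * f z"
    using Cauchy_integral_circlepath[OF assms(1,2), of z] z by (auto intro: contour_integral_unique)
  ultimately show ?thesis by (simp add: mult_ac)
qed

lemma mean_value_circ:
  fixes f :: "complex \<Rightarrow> complex"
  assumes "continuous_on (cball 0 1) f" "f holomorphic_on ball 0 1"
  shows "(LINT \<theta>|circ. f (cis \<theta>)) = 2 * pi * f 0"
  using Cauchy_mean[OF assms, of 0] by simp

text \<open>The Poisson kernel at the point z of the disc, normalised to have mean 1 over an interval of
length 2 \<pi>.\<close>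

definition poisson :: "complex \<Rightarrow> real \<Rightarrow> real" where
  "poisson z \<theta> = (1 - (norm z)\<^sup>2) / (norm (cis \<theta> - z))\<^sup>2"

lemma poisson_nonneg: "norm z < 1 \<Longrightarrow> 0 \<le> poisson z \<theta>"
  by (simp add: poisson_def abs_square_le_1)

lemma continuous_on_poisson: "norm z < 1 \<Longrightarrow> continuous_on A (poisson z)"
  unfolding poisson_def by (intro continuous_intros) (auto dest: arg_cong[where f = norm])

text \<open>Rather than subtracting a reflected Cauchy kernel, apply the Cauchy formula at z to
f(w) (1 - |z|^2) / (1 - cnj z * w). The factor is 1 at w = z, and on the circle it multiplies
the Cauchy kernel to the Poisson kernel.\<close>

lemma Poisson_mean:
  fixes f :: "complex \<Rightarrow> complex"
  assumes "continuous_on (cball 0 1) f" "f holomorphic_on ball 0 1" and z: "norm z < 1"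
  shows "(LINT \<theta>|circ. f (cis \<theta>) * poisson z \<theta>) = 2 * pi * f z"
proof -
  have nz: "1 - cnj z * w \<noteq> 0" if "norm w \<le> 1" for w
  proof
    assume "1 - cnj z * w = 0"
    then have "norm (cnj z * w) = 1" by (metis eq_iff_diff_eq_0 norm_one)
    moreover have "norm (cnj z * w) \<le> norm z * 1"
      unfolding norm_mult complex_mod_cnj using that by (intro mult_left_mono) auto
    ultimately show False using z by simp
  qed
  let ?F = "\<lambda>w. (1 - (norm z)\<^sup>2) * f w / (1 - cnj z * w)"
  have "(LINT \<theta>|circ. ?F (cis \<theta>) * cis \<theta> / (cis \<theta> - z)) = 2 * pi * ?F z"
    by (rule Cauchy_mean) (use assms nz in \<open>auto intro!: continuous_intros holomorphic_intros\<close>)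
  also have "?F z = f z"
  proof -
    have "(complex_of_real (norm z))\<^sup>2 = z * cnj z"
      by (metis complex_norm_square of_real_power)
    then show ?thesis using nz[of z] z by (simp add: mult.commute)
  qed
  also have "(\<lambda>\<theta>. ?F (cis \<theta>) * cis \<theta> / (cis \<theta> - z)) = (\<lambda>\<theta>. f (cis \<theta>) * poisson z \<theta>)"
  proof
    fix \<theta>
    have eq: "of_real ((norm (cis \<theta> - z))\<^sup>2) = (cis \<theta> - z) * (cnj (cis \<theta>) - cnj z)"
      by (simp only: complex_norm_square complex_cnj_diff)
    have *: "of_real ((norm (cis \<theta> - z))\<^sup>2) * cis \<theta> = (cis \<theta> - z) * (1 - cnj z * cis \<theta>)"
    proof -
      have "of_real ((norm (cis \<theta> - z))\<^sup>2) * cis \<theta> = (cis \<theta> - z) * (cis \<theta> * cnj (cis \<theta>) - cnj z * cis \<theta>)"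
        unfolding eq by (simp only: algebra_simps)
      also have "cis \<theta> * cnj (cis \<theta>) = 1" by (simp add: cis_cnj cis_mult)
      finally show ?thesis .
    qed
    have nz1: "cis \<theta> - z \<noteq> 0"
      using z by auto
    have nz2: "1 - cnj z * cis \<theta> \<noteq> 0"
      by (rule nz) simp
    have "cis \<theta> / ((cis \<theta> - z) * (1 - cnj z * cis \<theta>)) = 1 / of_real ((norm (cis \<theta> - z))\<^sup>2)"
      using nz1 nz2 by (simp only: divide_eq_eq eq_divide_eq flip: *) simp
    then show "?F (cis \<theta>) * cis \<theta> / (cis \<theta> - z) = f (cis \<theta>) * poisson z \<theta>"
      using nz1 nz2 by (simp add: poisson_def) (simp add: divide_simps mult_ac)
  qed
  finally show ?thesis .
qed

lemma dilation_holomorphic: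
  fixes f :: "complex \<Rightarrow> complex"
  assumes "f holomorphic_on ball 0 1" "0 \<le> r" "r < 1"
  shows "(\<lambda>z. f (of_real r * z)) holomorphic_on cball 0 1"
proof (rule holomorphic_on_compose_gen[where g = f and f = "\<lambda>z. of_real r * z", unfolded o_def])
  show "(\<lambda>z. of_real r * z) ` cball 0 1 \<subseteq> ball (0::complex) 1"
  proof clarsimp
    fix z :: complex assume "norm z \<le> 1"
    then have "\<bar>r\<bar> * norm z \<le> \<bar>r\<bar> * 1" by (intro mult_left_mono) auto
    then show "norm (of_real r * z) < 1" using assms by (simp add: norm_mult)
  qed
qed (use assms in \<open>auto intro: holomorphic_intros\<close>)

lemma dilation_continuous:
  fixes f :: "complex \<Rightarrow> complex"
  assumes "f holomorphic_on ball 0 1" "0 \<le> r" "r < 1"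
  shows "continuous_on A (\<lambda>\<theta>. f (of_real r * cis \<theta>))"
  using continuous_on_circle[OF holomorphic_on_imp_continuous_on[OF dilation_holomorphic[OF assms]]] .

lemmas dilation_ball = dilation_holomorphic[THEN holomorphic_on_subset, OF _ _ _ ball_subset_cball]
lemmas dilation_cball = dilation_holomorphic[THEN holomorphic_on_imp_continuous_on]

lemma taylor_coefficient_mean:
  fixes f :: "complex \<Rightarrow> complex"
  assumes "f holomorphic_on ball 0 1" "0 \<le> r" "r < 1"
  shows "(LINT \<theta>|circ. f (of_real r * cis \<theta>) * cnj (cis \<theta> ^ n)) =
           2 * pi * ((deriv ^^ n) f 0 / fact n * of_real r ^ n)"
proof -
  let ?g = "\<lambda>z. f (of_real r * z)"
  have "contour_integral (circlepath 0 1) (\<lambda>u. ?g u / (u - 0) ^ Suc n) = (2 * pi * \<i>) * (deriv ^^ n) ?g 0 / fact n"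
    by (rule Cauchy_contour_integral_circlepath) (use dilation_ball[OF assms] dilation_cball[OF assms] in auto)
  also have "(deriv ^^ n) ?g 0 = of_real r ^ n * (deriv ^^ n) f (of_real r * 0)"
  proof (rule higher_deriv_compose_linear[OF assms(1) open_ball open_ball])
    show "(0::complex) \<in> ball 0 1" by simp
    fix w :: complex assume "w \<in> ball 0 1"
    then show "of_real r * w \<in> ball 0 1"
      using assms mult_left_le_one_le[of "norm w" r] by (simp add: norm_mult)
  qed
  also have "contour_integral (circlepath 0 1) (\<lambda>u. ?g u / (u - 0) ^ Suc n) =
     \<i> * (LINT \<theta>|circ. ?g (cis \<theta>) / (cis \<theta> - 0) ^ Suc n * cis \<theta>)"
    by (intro contour_integral_unit_circle integrable_circ_continuous continuous_intros dilation_continuous assms) auto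
  also have "(\<lambda>\<theta>. ?g (cis \<theta>) / (cis \<theta> - 0) ^ Suc n * cis \<theta>) = (\<lambda>\<theta>. ?g (cis \<theta>) * cnj (cis \<theta> ^ n))"
    by (simp add: cis_cnj power_inverse divide_inverse fun_eq_iff flip: cis_inverse)
  finally have "\<i> * (LINT \<theta>|circ. ?g (cis \<theta>) * cnj (cis \<theta> ^ n)) =
      \<i> * (2 * pi * ((deriv ^^ n) f 0 / fact n * of_real r ^ n))"
    by (simp add: mult_ac)
  then show ?thesis by (simp only: mult_cancel_left) simp
qed

lemma taylor_summable:
  fixes f :: "complex \<Rightarrow> complex"
  assumes "f holomorphic_on ball 0 1" "norm z < 1"
  shows "summable (\<lambda>n. norm ((deriv ^^ n) f 0 / fact n * z ^ n))"
proof (rule powser_insidea)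
  define x where "x = complex_of_real ((norm z + 1) / 2)"
  have nx: "norm x = (norm z + 1) / 2" unfolding x_def norm_of_real by simp
  show "norm z < norm x" using assms nx by simp
  have "x \<in> ball 0 1" using assms nx by simp
  from holomorphic_power_series[OF assms(1) this]
  show "summable (\<lambda>n. (deriv ^^ n) f 0 / fact n * x ^ n)"
    by (simp add: sums_iff)
qed

text \<open>The case of two different radii is what the convergence of dilations needs.\<close>

lemma Parseval:
  fixes f :: "complex \<Rightarrow> complex"
  defines "a \<equiv> \<lambda>n. (deriv ^^ n) f 0 / fact n"
  assumes f: "f holomorphic_on ball 0 1" and r: "0 \<le> r" "r < 1" and s: "0 \<le> s" "s < 1"
  shows "summable (\<lambda>n. (norm (a n))\<^sup>2 * (r * s) ^ n)"
    and "(LINT \<theta>|circ. f (of_real r * cis \<theta>) * cnj (f (of_real s * cis \<theta>))) =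
           of_real (2 * pi * (\<Sum>n. (norm (a n))\<^sup>2 * (r * s) ^ n))"
proof -
  let ?c = "\<lambda>\<theta>. cnj (f (of_real s * cis \<theta>))"
  let ?u = "\<lambda>n \<theta>. a n * (of_real r * cis \<theta>) ^ n * ?c \<theta>"
  have int: "integrable circ (?u n)" for n
    by (intro integrable_circ_continuous continuous_intros dilation_continuous f s)
  have absum: "summable (\<lambda>n. norm (a n * of_real r ^ n))"
    using taylor_summable[OF f, of "of_real r"] r by (simp add: a_def)
  have nu: "norm (?u n \<theta>) = norm (a n * of_real r ^ n) * norm (?c \<theta>)" for n \<theta>
    by (simp add: norm_mult norm_power)
  have ser: "(\<lambda>n. ?u n \<theta>) sums (f (of_real r * cis \<theta>) * ?c \<theta>)" for \<theta>
    using holomorphic_power_series[OF f, of "of_real r * cis \<theta>"] r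
    by (intro sums_mult2) (simp add: a_def norm_mult)
  have "(\<lambda>n. LINT \<theta>|circ. ?u n \<theta>) sums (LINT \<theta>|circ. (\<Sum>n. ?u n \<theta>))"
  proof (rule sums_integral)
    show "AE \<theta> in circ. summable (\<lambda>n. norm (?u n \<theta>))"
      unfolding nu by (intro AE_I2 summable_mult2 absum)
    show "summable (\<lambda>n. LINT \<theta>|circ. norm (?u n \<theta>))"
      unfolding nu by (simp add: summable_mult2 absum)
  qed (rule int)
  also have "(\<lambda>n. LINT \<theta>|circ. ?u n \<theta>) = (\<lambda>n. of_real (2 * pi * ((norm (a n))\<^sup>2 * (r * s) ^ n)))"
  proof
    fix n
    have "?u n \<theta> = a n * of_real r ^ n * cnj (f (of_real s * cis \<theta>) * cnj (cis \<theta> ^ n))" for \<theta>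
      by (simp add: power_mult_distrib mult_ac)
    then have "(LINT \<theta>|circ. ?u n \<theta>) = a n * of_real r ^ n * cnj (LINT \<theta>|circ. f (of_real s * cis \<theta>) * cnj (cis \<theta> ^ n))"
      by (simp only: integral_mult_right_zero Bochner_Integration.integral_cnj flip: complex_cnj_mult)
    also have "\<dots> = a n * of_real r ^ n * cnj (2 * pi * (a n * of_real s ^ n))"
      unfolding taylor_coefficient_mean[OF f s] a_def ..
    also have "\<dots> = 2 * pi * ((a n * cnj (a n)) * (of_real r * of_real s) ^ n)"
      by (simp add: power_mult_distrib mult_ac)
    also have "\<dots> = of_real (2 * pi * ((norm (a n))\<^sup>2 * (r * s) ^ n))"
    proof -
      define N where "N = (norm (a n))\<^sup>2"
      have "of_real N = a n * cnj (a n)" unfolding N_def by (rule complex_norm_square)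
      then show ?thesis unfolding N_def[symmetric] by (simp only: of_real_mult of_real_power)
    qed
    finally show "(LINT \<theta>|circ. ?u n \<theta>) = of_real (2 * pi * ((norm (a n))\<^sup>2 * (r * s) ^ n))" .
  qed
  also have "(LINT \<theta>|circ. (\<Sum>n. ?u n \<theta>)) = (LINT \<theta>|circ. f (of_real r * cis \<theta>) * ?c \<theta>)"
    using ser by (simp add: sums_iff)
  finally have *: "(\<lambda>n. complex_of_real (2 * pi * ((norm (a n))\<^sup>2 * (r * s) ^ n))) sums (LINT \<theta>|circ. f (of_real r * cis \<theta>) * ?c \<theta>)" .
  then have "summable (\<lambda>n. 2 * pi * ((norm (a n))\<^sup>2 * (r * s) ^ n))"
    using sums_summable summable_complex_of_real by blast
  then show sm: "summable (\<lambda>n. (norm (a n))\<^sup>2 * (r * s) ^ n)"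
    by (subst (asm) summable_cmult_iff) auto
  then have "(\<lambda>n. complex_of_real (2 * pi * ((norm (a n))\<^sup>2 * (r * s) ^ n))) sums of_real (2 * pi * (\<Sum>n. (norm (a n))\<^sup>2 * (r * s) ^ n))"
    by (intro sums_of_real sums_mult summable_sums)
  with * show "(LINT \<theta>|circ. f (of_real r * cis \<theta>) * ?c \<theta>) = of_real (2 * pi * (\<Sum>n. (norm (a n))\<^sup>2 * (r * s) ^ n))"
    by (rule sums_unique2)
qed

text \<open>By Parseval, the inner product of the dilations by r and s is a function m(r s) with m
increasing and bounded on [0, 1), up to the factor 2 \<pi>. For r and s near 1 all of m(r r), m(s s)
and m(r s) are close to the supremum of m, so the squared distance, which is
2 \<pi> (m(r r) + m(s s) - 2 m(r s)), is small.\<close>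

lemma dilations_L2_Cauchy:
  fixes f :: "complex \<Rightarrow> complex"
  assumes f: "f holomorphic_on ball 0 1" and bd: "\<And>z. norm z < 1 \<Longrightarrow> norm (f z) \<le> B" and "0 < e"
  obtains \<rho> where "0 < \<rho>" "\<rho> < 1"
    "\<And>r s. \<rho> \<le> r \<Longrightarrow> r < 1 \<Longrightarrow> \<rho> \<le> s \<Longrightarrow> s < 1 \<Longrightarrow>
       (LINT \<theta>|circ. (norm (f (of_real r * cis \<theta>) - f (of_real s * cis \<theta>)))\<^sup>2) < e"
proof -
  define m where "m t = (\<Sum>n. (norm ((deriv ^^ n) f 0 / fact n))\<^sup>2 * t ^ n)" for t :: real
  note P = Parseval[OF f]
  have summ: "summable (\<lambda>n. (norm ((deriv ^^ n) f 0 / fact n))\<^sup>2 * t ^ n)" if "0 \<le> t" "t < 1" for t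
    using P(1)[of "sqrt t" "sqrt t"] that by simp
  have pm: "(LINT \<theta>|circ. f (of_real r * cis \<theta>) * cnj (f (of_real s * cis \<theta>))) = of_real (2 * pi * m (r * s))"
    if "0 \<le> r" "r < 1" "0 \<le> s" "s < 1" for r s
    using P(2)[OF that] by (simp add: m_def)
  have int2: "integrable circ (\<lambda>\<theta>. f (of_real r * cis \<theta>) * cnj (f (of_real s * cis \<theta>)))"
    if "0 \<le> r" "r < 1" "0 \<le> s" "s < 1" for r s
    by (intro integrable_circ_continuous continuous_intros dilation_continuous f that)
  have mono: "m t \<le> m t'" if "0 \<le> t" "t \<le> t'" "t' < 1" for t t'
    unfolding m_def using that by (intro suminf_le mult_left_mono power_mono summ) auto
  have mB: "m t \<le> B\<^sup>2" if t: "0 \<le> t" "t < 1" for t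
  proof -
    have s: "0 \<le> sqrt t" "sqrt t < 1" using t by auto
    have "2 * pi * m t = Re (LINT \<theta>|circ. f (of_real (sqrt t) * cis \<theta>) * cnj (f (of_real (sqrt t) * cis \<theta>)))"
      using pm[OF s s] t by simp
    also have "\<dots> = (LINT \<theta>|circ. (norm (f (of_real (sqrt t) * cis \<theta>)))\<^sup>2)"
      unfolding integral_Re[symmetric, OF int2[OF s s]] complex_norm_square[symmetric]
      by (simp only: integral_complex_of_real Re_complex_of_real)
    also have "\<dots> \<le> (LINT \<theta>|circ. B\<^sup>2)"
      using s by (intro integral_mono integrable_circ_continuous continuous_intros dilation_continuous f power_mono bd)
                 (auto simp: norm_mult)
    also have "\<dots> = 2 * pi * B\<^sup>2" using measure_circ by simp
    finally show ?thesis by simp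
  qed
  define L where "L = (SUP t\<in>{0..<1}. m t)"
  have bdd: "bdd_above (m ` {0..<1})" by (rule bdd_aboveI2[of _ _ "B\<^sup>2"]) (use mB in auto)
  have mL: "m t \<le> L" if "0 \<le> t" "t < 1" for t
    unfolding L_def using that by (intro cSUP_upper bdd) auto
  \<comment> \<open>The squared distance will be below 2 * pi * (2 * \<eta>).\<close>
  define \<eta> where "\<eta> = e / (4 * pi)"
  have "L - \<eta> < L" using \<open>0 < e\<close> by (simp add: \<eta>_def)
  then obtain t1 where t1: "0 \<le> t1" "t1 < 1" "L - \<eta> < m t1"
    using less_cSUP_iff[OF _ bdd, folded L_def, of "L - \<eta>"] by auto
  \<comment> \<open>Any radius in (0, 1) with square at least t1 would do; averaging with 1 keeps it positive if t1 = 0.\<close>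
  define \<rho> where "\<rho> = sqrt ((t1 + 1) / 2)"
  have \<rho>: "0 < \<rho>" "\<rho> < 1" using t1 by (auto simp: \<rho>_def)
  have \<rho>t: "t1 \<le> x * y" if "\<rho> \<le> x" "\<rho> \<le> y" for x y
  proof -
    have "t1 \<le> \<rho> * \<rho>" using t1 by (simp add: \<rho>_def)
    also have "\<dots> \<le> x * y" using that \<rho> by (intro mult_mono) auto
    finally show ?thesis .
  qed
  have sub: "0 \<le> x * y" "x * y < 1" if "\<rho> \<le> x" "x < 1" "\<rho> \<le> y" "y < 1" for x y
  proof -
    show "0 \<le> x * y" using that \<rho> by simp
    have "x * y \<le> x * 1" using that \<rho> by (intro mult_left_mono) auto
    then show "x * y < 1" using that by simp
  qed
  have lo: "L - \<eta> < m (x * y)" if "\<rho> \<le> x" "x < 1" "\<rho> \<le> y" "y < 1" for x y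
    using \<rho>t[of x y] that t1 mono[of t1 "x * y"] sub[OF that] by linarith
  have hi: "m (x * y) \<le> L" if "\<rho> \<le> x" "x < 1" "\<rho> \<le> y" "y < 1" for x y
    using sub[OF that] by (rule mL)
  show thesis
  proof (rule that[OF \<rho>])
    fix r s assume r: "\<rho> \<le> r" "r < 1" and s: "\<rho> \<le> s" "s < 1"
    have r0: "0 \<le> r" and s0: "0 \<le> s" using r s \<rho> by auto
    let ?r = "\<lambda>\<theta>. f (of_real r * cis \<theta>)" and ?s = "\<lambda>\<theta>. f (of_real s * cis \<theta>)"
    have "complex_of_real (LINT \<theta>|circ. (norm (?r \<theta> - ?s \<theta>))\<^sup>2) = (LINT \<theta>|circ. of_real ((norm (?r \<theta> - ?s \<theta>))\<^sup>2))"
      by (simp only: integral_complex_of_real)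
    also have "\<dots> = (LINT \<theta>|circ. ?r \<theta> * cnj (?r \<theta>) + ?s \<theta> * cnj (?s \<theta>) - ?r \<theta> * cnj (?s \<theta>) - ?s \<theta> * cnj (?r \<theta>))"
      by (intro Bochner_Integration.integral_cong refl, simp only: complex_norm_square) (simp add: algebra_simps)
    also have "\<dots> = of_real (2 * pi * (m (r * r) + m (s * s) - 2 * m (r * s)))"
      using r0 s0 r s by (simp add: int2 pm mult.commute[of s r]) (simp add: algebra_simps)
    finally have "(LINT \<theta>|circ. (norm (?r \<theta> - ?s \<theta>))\<^sup>2) = 2 * pi * (m (r * r) + m (s * s) - 2 * m (r * s))"
      by (simp only: of_real_eq_iff)
    also have "\<dots> < 2 * pi * (2 * \<eta>)"
      using lo[OF r s] hi[OF r r] hi[OF s s] by (intro mult_strict_left_mono) auto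
    also have "\<dots> = e" by (simp add: \<eta>_def)
    finally show "(LINT \<theta>|circ. (norm (?r \<theta> - ?s \<theta>))\<^sup>2) < e" .
  qed
qed

section \<open>Radial limits of bounded analytic functions\<close>

text \<open>The library theorem on averages over cubes yields, in dimension one, averages over intervals to
the right of the point. Applying it also to the reflected function gives the two-sided derivative
of the indefinite integral.\<close>

lemma Lebesgue_differentiation:
  fixes k :: "real \<Rightarrow> 'b::euclidean_space"
  assumes k: "\<And>a b. k integrable_on {a..b}"
  obtains N where "negligible N"
    "\<And>x a. x \<notin> N \<Longrightarrow> a < x \<Longrightarrow> ((\<lambda>t. integral {a..t} k) has_vector_derivative k x) (at x)"
proof -
  let ?k = "\<lambda>x. k (- x)"
  have k': "?k integrable_on {a..b}" for a b
    using Henstock_Kurzweil_Integration.integrable_reflect_real[where f = k and a = "- b" and b = "- a"] k[of "- b" "- a"]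
    by (simp only: minus_minus)
  obtain N1 where N1: "negligible N1"
    "\<And>x e. x \<notin> N1 \<Longrightarrow> 0 < e \<Longrightarrow> \<exists>d>0. \<forall>h. 0 < h \<and> h < d \<longrightarrow> norm (integral {x..x+h} k /\<^sub>R h - k x) < e"
    using integrable_ccontinuous_explicit[of k] k by (auto simp: cbox_interval)
  obtain N2 where N2: "negligible N2"
    "\<And>x e. x \<notin> N2 \<Longrightarrow> 0 < e \<Longrightarrow> \<exists>d>0. \<forall>h. 0 < h \<and> h < d \<longrightarrow> norm (integral {x..x+h} ?k /\<^sub>R h - ?k x) < e"
    using integrable_ccontinuous_explicit[of ?k] k' by (auto simp: cbox_interval)
  have scale: "norm (I - h *\<^sub>R v) \<le> e * h" if "0 < h" "norm (I /\<^sub>R h - v) < e" for I v :: 'b and h e :: real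
  proof -
    have "I - h *\<^sub>R v = h *\<^sub>R (I /\<^sub>R h - v)" using that by (simp add: scaleR_diff_right)
    then have "norm (I - h *\<^sub>R v) = h * norm (I /\<^sub>R h - v)" using that by simp
    also have "\<dots> \<le> h * e" using that by (intro mult_left_mono) auto
    finally show ?thesis by (simp add: mult.commute)
  qed
  show thesis
  proof
    show "negligible (N1 \<union> uminus ` N2)"
    proof (rule negligible_Un[OF N1(1) negligible_differentiable_image_negligible[OF _ N2(1)]])
      show "uminus differentiable_on N2" by (intro derivative_intros)
    qed simp
    fix x a assume x: "x \<notin> N1 \<union> uminus ` N2" and a: "a < x"
    then have x1: "x \<notin> N1" and x2: "- x \<notin> N2" by force+
    show "((\<lambda>t. integral {a..t} k) has_vector_derivative k x) (at x)"
      unfolding has_vector_derivative_def has_derivative_within_alt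
    proof (intro conjI allI impI bounded_linear_scaleR_left)
      fix e :: real assume "0 < e"
      obtain d1 where d1: "d1 > 0" "\<And>h. 0 < h \<Longrightarrow> h < d1 \<Longrightarrow> norm (integral {x..x+h} k /\<^sub>R h - k x) < e"
        using N1(2)[OF x1 \<open>0 < e\<close>] by auto
      obtain d2 where d2: "d2 > 0" "\<And>h. 0 < h \<Longrightarrow> h < d2 \<Longrightarrow> norm (integral {-x..-x+h} ?k /\<^sub>R h - k x) < e"
        using N2(2)[OF x2 \<open>0 < e\<close>] by auto
      let ?d = "min (min d1 d2) (x - a)"
      show "\<exists>d>0. \<forall>y\<in>UNIV. norm (y - x) < d \<longrightarrow>
               norm (integral {a..y} k - integral {a..x} k - (y - x) *\<^sub>R k x) \<le> e * norm (y - x)"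
      proof (intro exI[of _ ?d] conjI ballI impI)
        show "?d > 0" using d1 d2 a by simp
        fix y assume y: "norm (y - x) < ?d"
        consider "y = x" | "y > x" | "y < x" by linarith
        then show "norm (integral {a..y} k - integral {a..x} k - (y - x) *\<^sub>R k x) \<le> e * norm (y - x)"
        proof cases
          case 2
          have "integral {a..x} k + integral {x..y} k = integral {a..y} k"
            by (rule Henstock_Kurzweil_Integration.integral_combine) (use 2 a k in auto)
          then have "integral {a..y} k - integral {a..x} k - (y - x) *\<^sub>R k x = integral {x..x+(y-x)} k - (y - x) *\<^sub>R k x"
            by (simp add: algebra_simps)
          then show ?thesis
            using scale[OF _ d1(2)[of "y - x"]] 2 y by simp
        next
          case 3
          have "integral {a..y} k + integral {y..x} k = integral {a..x} k"
            by (rule Henstock_Kurzweil_Integration.integral_combine) (use 3 a k y in auto)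
          moreover define I where "I = integral {-x..-x+(x-y)} ?k"
          have "integral {y..x} k = I" unfolding I_def
            using Henstock_Kurzweil_Integration.integral_reflect_real[where f = k and a = y and b = x] by simp
          ultimately have "integral {a..y} k - integral {a..x} k = - I"
            by (metis add_diff_cancel_left' minus_diff_eq)
          then have eq: "integral {a..y} k - integral {a..x} k - (y - x) *\<^sub>R k x = - (I - (x - y) *\<^sub>R k x)"
            by (simp add: scaleR_diff_left)
          have "norm (I - (x - y) *\<^sub>R k x) \<le> e * (x - y)"
          proof (rule scale)
            show "norm (I /\<^sub>R (x - y) - k x) < e"
              unfolding I_def by (rule d2(2)) (use 3 y in simp_all)
          qed (use 3 in simp)
          moreover have "x - y = norm (y - x)" using 3 by simp
          ultimately show ?thesis
            unfolding eq norm_minus_cancel by (simp only:)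
        qed simp
      qed
    qed
  qed
qed

text \<open>Nearness on the circle, measured in the plane, is turned into nearness of suitable angles. The
argument is continuous only away from the negative axis, so the point is rotated to 1 first.\<close>

lemma circle_near:
  fixes \<theta> d :: real
  assumes "0 < d"
  obtains \<delta> where "0 < \<delta>"
    "\<And>w. norm w = 1 \<Longrightarrow> norm (w - cis \<theta>) < \<delta> \<Longrightarrow> \<exists>t. \<bar>t - \<theta>\<bar> < d \<and> w = cis t"
proof -
  have "isCont Arg 1" by (rule continuous_at_Arg) (auto simp: complex_nonpos_Reals_iff)
  then obtain \<delta> where \<delta>: "0 < \<delta>" "\<And>u. dist u 1 < \<delta> \<Longrightarrow> dist (Arg u) (Arg 1) < d"
    using assms unfolding continuous_at_eps_delta by metis
  show thesis
  proof (rule that[OF \<delta>(1)])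
    fix w assume w: "norm w = 1" "norm (w - cis \<theta>) < \<delta>"
    let ?u = "w * cis (- \<theta>)"
    have "?u - 1 = (w - cis \<theta>) * cis (- \<theta>)" by (simp add: algebra_simps cis_mult)
    then have "dist ?u 1 < \<delta>" using w by (simp add: dist_norm norm_mult)
    then have "\<bar>Arg ?u\<bar> < d" using \<delta>(2)[of ?u] by (simp add: dist_norm)
    moreover have "cis (Arg ?u) = ?u" using w by (subst cis_Arg) (auto simp: sgn_div_norm norm_mult)
    then have "w = cis (\<theta> + Arg ?u)" by (simp add: mult.assoc cis_mult flip: cis_mult[of \<theta>])
    ultimately show "\<exists>t. \<bar>t - \<theta>\<bar> < d \<and> w = cis t"
      by (intro exI[of _ "\<theta> + Arg ?u"]) simp
  qed
qed

lemma has_vector_derivative_cis: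
  "(cis has_vector_derivative \<i> * cis \<theta>) (at \<theta> within A)"
  by (auto intro!: derivative_eq_intros simp: has_vector_derivative_def scaleR_conv_of_real mult_ac)

lemma vector_derivative_remainder:
  assumes "(f has_vector_derivative D) (at x)" "0 < e"
  shows "\<exists>d>0. \<forall>t. \<bar>t - x\<bar> < d \<longrightarrow> norm (f t - f x - (t - x) *\<^sub>R D) \<le> e * \<bar>t - x\<bar>"
  using assms unfolding has_vector_derivative_def has_derivative_within_alt by auto

text \<open>A vanishing derivative with respect to the angle gives smallness relative to the angle. Since cis
has derivative of modulus 1, the angle is at most twice the chord near the point, so smallness
relative to the chord follows.\<close>

lemma boundary_derivative_on_circle:
  fixes E :: "complex \<Rightarrow> complex"
  assumes E0: "E (cis \<theta>) = 0"
    and der: "((\<lambda>t. E (cis t)) has_vector_derivative 0) (at \<theta>)" and e: "0 < e"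
  obtains \<delta> where "0 < \<delta>" "\<And>w. norm w = 1 \<Longrightarrow> norm (w - cis \<theta>) < \<delta> \<Longrightarrow> norm (E w) \<le> e * norm (w - cis \<theta>)"
proof -
  obtain d1 where d1: "d1 > 0"
    "\<And>t. \<bar>t - \<theta>\<bar> < d1 \<Longrightarrow> norm (cis t - cis \<theta> - (t - \<theta>) *\<^sub>R (\<i> * cis \<theta>)) \<le> 1/2 * \<bar>t - \<theta>\<bar>"
    using vector_derivative_remainder[OF has_vector_derivative_cis, of "1/2"] by auto
  obtain d2 where d2: "d2 > 0" "\<And>t. \<bar>t - \<theta>\<bar> < d2 \<Longrightarrow> norm (E (cis t)) \<le> e/2 * \<bar>t - \<theta>\<bar>"
    using vector_derivative_remainder[OF der, of "e/2"] e by (auto simp: E0)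
  obtain \<delta> where \<delta>: "0 < \<delta>" "\<And>w. norm w = 1 \<Longrightarrow> norm (w - cis \<theta>) < \<delta> \<Longrightarrow> \<exists>t. \<bar>t - \<theta>\<bar> < min d1 d2 \<and> w = cis t"
    using circle_near[of "min d1 d2" \<theta>] d1 d2 by (metis min_less_iff_conj)
  show thesis
  proof (rule that[OF \<delta>(1)])
    fix w assume "norm w = 1" "norm (w - cis \<theta>) < \<delta>"
    then obtain t where t: "\<bar>t - \<theta>\<bar> < min d1 d2" "w = cis t" using \<delta>(2) by blast
    have "\<bar>t - \<theta>\<bar> = norm ((t - \<theta>) *\<^sub>R (\<i> * cis \<theta>))" by (simp add: norm_mult)
    also have "\<dots> \<le> norm (cis t - cis \<theta>) + norm (cis t - cis \<theta> - (t - \<theta>) *\<^sub>R (\<i> * cis \<theta>))"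
      by (metis norm_triangle_sub norm_minus_commute add.commute)
    also have "\<dots> \<le> norm (cis t - cis \<theta>) + 1/2 * \<bar>t - \<theta>\<bar>"
      using d1(2)[of t] t by simp
    finally have "\<bar>t - \<theta>\<bar> \<le> 2 * norm (w - cis \<theta>)" using t by simp
    then have "e/2 * \<bar>t - \<theta>\<bar> \<le> e/2 * (2 * norm (w - cis \<theta>))" using e by (intro mult_left_mono) auto
    with d2(2)[of t] t show "norm (E w) \<le> e * norm (w - cis \<theta>)" by simp
  qed
qed

text \<open>The key step from the boundary to the interior. Since |1 - w cnj z0| is the chord |w - z0| and
1 - w cnj z0 has nonnegative real part on the closed disc, the analytic function
(1 - w cnj z0) (e + C (1 - w cnj z0)) has modulus at least e |w - z0| and at least C |w - z0|^2.
The first bound controls E near z0 and the second one, for large C, away from z0. The maximum modulus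
principle then applies to the quotient. Adding a small \<eta> to the first factor keeps the denominator
free of zeros on the closed disc, including at z0.\<close>

lemma boundary_zero_in_disc:
  fixes E :: "complex \<Rightarrow> complex"
  assumes cont: "continuous_on (cball 0 1) E" and hol: "E holomorphic_on ball 0 1"
    and z0: "norm z0 = 1" and e: "0 < e" and \<delta>: "0 < \<delta>"
    and near: "\<And>w. norm w = 1 \<Longrightarrow> norm (w - z0) < \<delta> \<Longrightarrow> norm (E w) \<le> e * norm (w - z0)"
  obtains C where "0 \<le> C" "\<And>z. norm z \<le> 1 \<Longrightarrow> norm (E z) \<le> norm (z - z0) * (e + C * norm (z - z0))"
proof -
  have "bounded (E ` cball 0 1)"
    by (intro compact_imp_bounded compact_continuous_image cont compact_cball)
  then obtain M where M: "\<And>z. norm z \<le> 1 \<Longrightarrow> norm (E z) \<le> M" "0 < M"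
    by (force simp: bounded_pos)
  \<comment> \<open>With this C the quadratic term alone exceeds M at distance at least \<delta> from z0.\<close>
  define C where "C = M / \<delta>\<^sup>2"
  have C: "0 < C" using M \<delta> by (simp add: C_def)
  define u where "u z = 1 - cnj z0 * z" for z
  have nu: "norm (u z) = norm (z - z0)" for z
  proof -
    have "u z = - cnj z0 * (z - z0)"
      using z0 complex_norm_square[of z0] by (simp add: u_def algebra_simps)
    then show ?thesis using z0 by (simp add: norm_mult)
  qed
  have reu: "0 \<le> Re (u z)" if "norm z \<le> 1" for z
  proof -
    have "Re (cnj z0 * z) \<le> norm (cnj z0 * z)" by (rule complex_Re_le_cmod)
    also have "\<dots> \<le> 1" using that z0 by (simp add: norm_mult)
    finally show ?thesis by (simp add: u_def)
  qed
  have shift: "norm v \<le> norm (of_real x + v)" "x \<le> norm (of_real x + v)" if "0 \<le> x" "0 \<le> Re v" for x v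
  proof -
    have "(norm v)\<^sup>2 \<le> (norm (of_real x + v))\<^sup>2"
      using that by (auto simp: cmod_power2 intro!: power_mono)
    then show "norm v \<le> norm (of_real x + v)" by (rule power2_le_imp_le) simp
    show "x \<le> norm (of_real x + v)"
      using complex_Re_le_cmod[of "of_real x + v"] that by simp
  qed
  have bound: "norm (E z) \<le> norm (of_real \<eta> + u z) * norm (of_real e + of_real C * u z)"
    if "0 < \<eta>" "norm z \<le> 1" for \<eta> z
  proof -
    let ?D = "\<lambda>z. (of_real \<eta> + u z) * (of_real e + of_real C * u z)"
    have Dnz: "?D w \<noteq> 0" if "norm w \<le> 1" for w
    proof -
      have "0 < Re (of_real \<eta> + u w)" using reu[OF that] \<open>0 < \<eta>\<close> by simp
      moreover have "0 < Re (of_real e + of_real C * u w)" using reu[OF that] e C by (simp add: add_pos_nonneg)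
      ultimately show ?thesis by (metis mult_eq_0_iff less_irrefl zero_complex.simps(1))
    qed
    have quot: "norm (a / D) \<le> 1 \<longleftrightarrow> norm a \<le> norm D" if "D \<noteq> 0" for a D :: complex
      using that by (simp add: norm_divide divide_le_eq_1_pos)
    have contu: "continuous_on A u" for A unfolding u_def by (intro continuous_intros)
    have holu: "u holomorphic_on A" for A unfolding u_def by (intro holomorphic_intros)
    have "norm (E z / ?D z) \<le> 1"
    proof (rule maximum_modulus_frontier[where S = "cball 0 1" and f = "\<lambda>z. E z / ?D z" and \<xi> = z])
      show "(\<lambda>z. E z / ?D z) holomorphic_on interior (cball 0 1)"
        using Dnz by (auto intro!: holomorphic_intros hol holu)
      show "continuous_on (closure (cball 0 1)) (\<lambda>z. E z / ?D z)"
        using Dnz by (auto intro!: continuous_intros cont contu)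
      fix w :: complex assume "w \<in> frontier (cball 0 1)"
      then have w: "norm w = 1" by (simp add: frontier_def dist_norm)
      have 1: "norm (w - z0) \<le> norm (of_real \<eta> + u w)"
        using shift(1)[of \<eta> "u w"] reu[of w] w \<open>0 < \<eta>\<close> nu by simp
      have rC: "0 \<le> Re (of_real C * u w)" using reu[of w] w C by simp
      have "norm (E w) \<le> norm (w - z0) * norm (of_real e + of_real C * u w)"
      proof (cases "norm (w - z0) < \<delta>")
        case True
        have "norm (E w) \<le> norm (w - z0) * e" using near[OF w True] by (simp add: mult.commute)
        also have "\<dots> \<le> norm (w - z0) * norm (of_real e + of_real C * u w)"
          using shift(2)[of e "of_real C * u w"] rC e by (intro mult_left_mono) auto
        finally show ?thesis .
      next
        case False
        have "norm (E w) \<le> M" using M w by simp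
        also have "\<dots> = C * \<delta>\<^sup>2" using \<delta> by (simp add: C_def)
        also have "\<dots> \<le> C * (norm (w - z0))\<^sup>2" using False C \<delta> by (intro mult_left_mono power_mono) auto
        also have "\<dots> = norm (w - z0) * norm (of_real C * u w)"
          using C by (simp add: norm_mult nu power2_eq_square)
        also have "\<dots> \<le> norm (w - z0) * norm (of_real e + of_real C * u w)"
          using shift(1)[of e "of_real C * u w"] rC e by (intro mult_left_mono) auto
        finally show ?thesis .
      qed
      also have "\<dots> \<le> norm (of_real \<eta> + u w) * norm (of_real e + of_real C * u w)"
        using 1 by (intro mult_right_mono) auto
      finally show "norm (E w / ?D w) \<le> 1"
        using quot[OF Dnz] w by (simp add: norm_mult)
    qed (use that in auto)
    then show ?thesis
      using quot[OF Dnz] that by (simp add: norm_mult)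
  qed
  show thesis
  proof (rule that[of C])
    fix z :: complex assume z: "norm z \<le> 1"
    have "((\<lambda>\<eta>. norm (complex_of_real \<eta> + u z) * norm (of_real e + of_real C * u z)) \<longlongrightarrow>
             norm (complex_of_real 0 + u z) * norm (of_real e + of_real C * u z)) (at_right 0)"
      by (intro tendsto_intros)
    then have "norm (E z) \<le> norm (complex_of_real 0 + u z) * norm (of_real e + of_real C * u z)"
      by (rule tendsto_lowerbound) (use bound z in \<open>auto simp: eventually_at_filter\<close>)
    also have "\<dots> \<le> norm (z - z0) * (e + C * norm (z - z0))"
      using e C norm_triangle_ineq[of "of_real e" "of_real C * u z"]
      by (intro mult_mono) (auto simp: nu norm_mult)
    finally show "norm (E z) \<le> norm (z - z0) * (e + C * norm (z - z0))" .
  qed (use C in simp)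
qed

text \<open>Subtract the first order expansion of F at the boundary point. The remainder E is o(|z - cis \<theta>|)
in the whole disc, and Cauchy's estimate on the disc about r cis \<theta> of radius 1 - r shows that
E' = f - A tends to 0 along the radius.\<close>

lemma radial_limit_of_derivative:
  fixes F f :: "complex \<Rightarrow> complex"
  assumes cont: "continuous_on (cball 0 1) F"
    and der: "\<And>z. norm z < 1 \<Longrightarrow> (F has_field_derivative f z) (at z)"
    and bder: "((\<lambda>t. F (cis t)) has_vector_derivative A * (\<i> * cis \<theta>)) (at \<theta>)"
  shows "((\<lambda>r. f (of_real r * cis \<theta>)) \<longlongrightarrow> A) (at_left 1)"
proof -
  define E where "E z = F z - F (cis \<theta>) - A * (z - cis \<theta>)" for z
  have contE: "continuous_on (cball 0 1) E"
    unfolding E_def by (intro continuous_intros cont)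
  have derE: "(E has_field_derivative f z - A) (at z)" if "norm z < 1" for z
    unfolding E_def by (auto intro!: derivative_eq_intros der that)
  then have holE: "E holomorphic_on ball 0 1"
    unfolding holomorphic_on_open[OF open_ball] by (metis dist_0_norm mem_ball)
  have bdE: "((\<lambda>t. E (cis t)) has_vector_derivative 0) (at \<theta>)"
    unfolding E_def by (auto intro!: derivative_eq_intros bder has_vector_derivative_cis)
  show ?thesis
  proof (rule tendstoI)
    fix e :: real assume e: "0 < e"
    define e' where "e' = e / 3"
    have e': "0 < e'" using e by (simp add: e'_def)
    obtain \<delta> where "0 < \<delta>" "\<And>w. norm w = 1 \<Longrightarrow> norm (w - cis \<theta>) < \<delta> \<Longrightarrow> norm (E w) \<le> e' * norm (w - cis \<theta>)"
      using boundary_derivative_on_circle[OF _ bdE e'] by (auto simp: E_def)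
    then obtain C where C: "0 \<le> C" "\<And>z. norm z \<le> 1 \<Longrightarrow> norm (E z) \<le> norm (z - cis \<theta>) * (e' + C * norm (z - cis \<theta>))"
      using boundary_zero_in_disc[OF contE holE _ e', of "cis \<theta>"] by (metis norm_cis)
    have est: "dist (f (of_real r * cis \<theta>)) A \<le> 2 * (e' + C * (2 * (1 - r)))" if r: "0 < r" "r < 1" for r
    proof -
      let ?x = "of_real r * cis \<theta>"
      have nx: "norm ?x = r" using r by (simp add: norm_mult)
      have xc: "norm (?x - cis \<theta>) = 1 - r"
      proof -
        have "?x - cis \<theta> = of_real (r - 1) * cis \<theta>" by (simp add: algebra_simps)
        then show ?thesis using r by (simp only: norm_mult norm_of_real) simp
      qed
      have sub: "norm y \<le> 1" if "norm (?x - y) \<le> 1 - r" for y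
        using norm_triangle_ineq2[of y ?x] that nx by (simp add: norm_minus_commute)
      have sub': "norm y < 1" if "norm (?x - y) < 1 - r" for y
        using norm_triangle_ineq2[of y ?x] that nx by (simp add: norm_minus_commute)
      have "norm ((deriv ^^ 1) E ?x) \<le> fact 1 * (2 * (1 - r) * (e' + C * (2 * (1 - r)))) / (1 - r) ^ 1"
      proof (rule Cauchy_inequality)
        show "E holomorphic_on ball ?x (1 - r)"
          by (rule holomorphic_on_subset[OF holE]) (use sub' in \<open>auto simp: dist_norm\<close>)
        show "continuous_on (cball ?x (1 - r)) E"
          by (rule continuous_on_subset[OF contE]) (use sub in \<open>auto simp: dist_norm\<close>)
        fix y assume y: "norm (?x - y) = 1 - r"
        have ny: "norm (y - cis \<theta>) \<le> 2 * (1 - r)"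
          using norm_triangle_ineq[of "y - ?x" "?x - cis \<theta>"] y xc by (simp add: norm_minus_commute)
        have "norm (E y) \<le> norm (y - cis \<theta>) * (e' + C * norm (y - cis \<theta>))"
          using C(2) sub y by simp
        also have "\<dots> \<le> 2 * (1 - r) * (e' + C * (2 * (1 - r)))"
          using ny C(1) e' r by (intro mult_mono add_left_mono mult_left_mono) auto
        finally show "norm (E y) \<le> 2 * (1 - r) * (e' + C * (2 * (1 - r)))" .
      qed (use r in simp)
      also have "(deriv ^^ 1) E ?x = f ?x - A"
        using DERIV_imp_deriv[OF derE[of ?x]] nx r by simp
      also have "fact 1 * (2 * (1 - r) * X) / (1 - r) ^ 1 = 2 * X" for X
        using r by (simp add: field_simps)
      finally show ?thesis by (simp only: dist_norm)
    qed
    have "((\<lambda>r. 2 * (e' + C * (2 * (1 - r)))) \<longlongrightarrow> 2 * (e' + C * (2 * (1 - 1)))) (at_left (1::real))"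
      by (intro tendsto_intros)
    then have "\<forall>\<^sub>F r in at_left (1::real). 2 * (e' + C * (2 * (1 - r))) < e"
      by (rule order_tendstoD) (use e in \<open>simp add: e'_def\<close>)
    moreover have "\<forall>\<^sub>F r in at_left (1::real). 0 < r \<and> r < 1"
      by (rule eventually_at_leftI[of 0]) auto
    ultimately show "\<forall>\<^sub>F r in at_left 1. dist (f (of_real r * cis \<theta>)) A < e"
      by eventually_elim (use est in fastforce)
  qed
qed

text \<open>A fixed sequence of radii increasing to 1, along which boundary functions are obtained as
pointwise limits of sequences, hence as measurable functions.\<close>

definition radii :: "nat \<Rightarrow> real" where
  "radii n = 1 - 1 / real (n + 2)"

lemma radii: "0 < radii n" "radii n < 1"
  by (auto simp: radii_def field_simps)

lemma radii_tendsto: "radii \<longlonglongrightarrow> 1"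
proof -
  have "(\<lambda>n. 1 / real (n + 2)) \<longlonglongrightarrow> 0"
    using lim_const_over_n[of 1] by (rule LIMSEQ_ignore_initial_segment)
  then have "(\<lambda>n. 1 - 1 / real (n + 2)) \<longlonglongrightarrow> 1 - 0" by (intro tendsto_intros)
  then show ?thesis by (simp add: radii_def[abs_def])
qed

lemma radii_at_left: "filterlim radii (at_left 1) sequentially"
  unfolding filterlim_at using radii radii_tendsto
  by (auto intro!: always_eventually simp: less_imp_neq)

lemma norm_radii_less: "norm (of_real (radii n) * cis \<theta>) < 1"
  using radii[of n] by (simp add: norm_mult)

lemma AE_circ_subinterval:
  assumes "AE \<theta> in circ. P \<theta>" "b \<le> 2 * pi"
  shows "AE \<theta> in lebesgue_on {0..b}. P \<theta>"
  using assms by (auto simp: AE_restrict_space_iff)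

text \<open>From squares to first powers by t \<le> \<eta> + t^2 / \<eta>.\<close>

lemma dilations_L1_Cauchy:
  fixes f :: "complex \<Rightarrow> complex"
  assumes f: "f holomorphic_on ball 0 1" and bd: "\<And>z. norm z < 1 \<Longrightarrow> norm (f z) \<le> B" and "0 < e"
  obtains \<rho> where "0 < \<rho>" "\<rho> < 1"
    "\<And>r s. \<rho> \<le> r \<Longrightarrow> r < 1 \<Longrightarrow> \<rho> \<le> s \<Longrightarrow> s < 1 \<Longrightarrow>
       (LINT \<theta>|circ. norm (f (of_real r * cis \<theta>) - f (of_real s * cis \<theta>))) < e"
proof -
  define \<eta> where "\<eta> = e / (4 * pi)"
  have \<eta>: "0 < \<eta>" using \<open>0 < e\<close> by (simp add: \<eta>_def)
  obtain \<rho> where \<rho>: "0 < \<rho>" "\<rho> < 1"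
    "\<And>r s. \<rho> \<le> r \<Longrightarrow> r < 1 \<Longrightarrow> \<rho> \<le> s \<Longrightarrow> s < 1 \<Longrightarrow>
       (LINT \<theta>|circ. (norm (f (of_real r * cis \<theta>) - f (of_real s * cis \<theta>)))\<^sup>2) < \<eta> * (e / 2)"
    using dilations_L2_Cauchy[OF f bd, of "\<eta> * (e / 2)"] \<eta> \<open>0 < e\<close> by auto
  show thesis
  proof (rule that[OF \<rho>(1,2)])
    fix r s assume r: "\<rho> \<le> r" "r < 1" and s: "\<rho> \<le> s" "s < 1"
    let ?X = "\<lambda>\<theta>. f (of_real r * cis \<theta>) - f (of_real s * cis \<theta>)"
    have cont: "continuous_on A ?X" for A
      using r s \<rho> by (intro continuous_intros dilation_continuous f) auto
    have le: "norm v \<le> \<eta> + (norm v)\<^sup>2 / \<eta>" for v :: complex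
    proof (cases "norm v \<le> \<eta>")
      case False
      then have "norm v * \<eta> \<le> norm v * norm v" using \<eta> by (intro mult_left_mono) auto
      then have "norm v \<le> (norm v)\<^sup>2 / \<eta>" using \<eta> by (simp add: pos_le_divide_eq power2_eq_square)
      then show ?thesis using \<eta> by linarith
    qed (use \<eta> in \<open>auto intro: add_increasing2\<close>)
    have "(LINT \<theta>|circ. norm (?X \<theta>)) \<le> (LINT \<theta>|circ. \<eta> + (norm (?X \<theta>))\<^sup>2 / \<eta>)"
      using \<eta> by (intro integral_mono integrable_circ_continuous continuous_intros cont le) auto
    also have "\<dots> = (LINT \<theta>|circ. \<eta>) + (LINT \<theta>|circ. (norm (?X \<theta>))\<^sup>2 / \<eta>)"
      using \<eta> by (intro Bochner_Integration.integral_add integrable_circ_continuous continuous_intros cont) auto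
    also have "\<dots> = 2 * pi * \<eta> + (LINT \<theta>|circ. (norm (?X \<theta>))\<^sup>2) / \<eta>"
      using measure_circ by simp
    also have "\<dots> < 2 * pi * \<eta> + \<eta> * (e / 2) / \<eta>"
      using \<rho>(3)[OF r s] \<eta> by (intro add_strict_left_mono divide_strict_right_mono) auto
    also have "\<dots> = e" using \<eta> by (simp add: \<eta>_def)
    finally show "(LINT \<theta>|circ. norm (?X \<theta>)) < e" .
  qed
qed

lemma boundary_function_along_sequence:
  fixes f :: "complex \<Rightarrow> complex"
  assumes f: "f holomorphic_on ball 0 1" and bd: "\<And>z. norm z < 1 \<Longrightarrow> norm (f z) \<le> B"
  obtains \<rho> :: "nat \<Rightarrow> real" and h where "\<And>n. 0 < \<rho> n" "\<And>n. \<rho> n < 1" "\<rho> \<longlonglongrightarrow> 1"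
    "h \<in> borel_measurable circ" "AE \<theta> in circ. (\<lambda>n. f (of_real (\<rho> n) * cis \<theta>)) \<longlonglongrightarrow> h \<theta>"
proof -
  let ?s = "\<lambda>n \<theta>. f (of_real (radii n) * cis \<theta>)"
  have int: "integrable circ (?s n)" for n
    using radii[of n] by (intro integrable_circ_continuous dilation_continuous f) auto
  obtain k :: "nat \<Rightarrow> nat" where k: "strict_mono k" "AE \<theta> in circ. Cauchy (\<lambda>i. ?s (k i) \<theta>)"
  proof (rule cauchy_L1_AE_cauchy_subseq[OF int])
    fix e :: real assume e: "0 < e"
    obtain \<rho> where \<rho>: "0 < \<rho>" "\<rho> < 1"
      "\<And>r s. \<rho> \<le> r \<Longrightarrow> r < 1 \<Longrightarrow> \<rho> \<le> s \<Longrightarrow> s < 1 \<Longrightarrow>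
         (LINT \<theta>|circ. norm (f (of_real r * cis \<theta>) - f (of_real s * cis \<theta>))) < e"
      by (rule dilations_L1_Cauchy[where f = f and B = B and e = e]) (use f bd e in blast)+
    obtain N where N: "\<And>n. n \<ge> N \<Longrightarrow> \<rho> < radii n"
      using order_tendstoD(1)[OF radii_tendsto \<rho>(2)] by (auto simp: eventually_sequentially)
    show "\<exists>N. \<forall>i\<ge>N. \<forall>j\<ge>N. (LINT \<theta>|circ. norm (?s i \<theta> - ?s j \<theta>)) < e"
    proof (intro exI[of _ N] allI impI)
      fix i j assume "N \<le> i" "N \<le> j"
      then show "(LINT \<theta>|circ. norm (?s i \<theta> - ?s j \<theta>)) < e"
        by (intro \<rho>(3) radii less_imp_le[OF N])
    qed
  qed
  show thesis
  proof (rule that[of "\<lambda>i. radii (k i)" "\<lambda>\<theta>. lim (\<lambda>i. ?s (k i) \<theta>)"])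
    show "(\<lambda>i. radii (k i)) \<longlonglongrightarrow> 1"
      using LIMSEQ_subseq_LIMSEQ[OF radii_tendsto k(1)] by (simp add: o_def)
    show "(\<lambda>\<theta>. lim (\<lambda>i. ?s (k i) \<theta>)) \<in> borel_measurable circ"
      by (rule borel_measurable_lim_metric) (use int in auto)
    show "AE \<theta> in circ. (\<lambda>n. ?s (k n) \<theta>) \<longlonglongrightarrow> lim (\<lambda>i. ?s (k i) \<theta>)"
      using k(2) by eventually_elim (metis Cauchy_convergent convergent_LIMSEQ_iff)
  qed (use radii in auto)
qed

text \<open>A primitive of a bounded function is Lipschitz on the disc, hence extends continuously to the
closed disc.\<close>

lemma bounded_has_continuous_primitive:
  fixes f :: "complex \<Rightarrow> complex"
  assumes f: "f holomorphic_on ball 0 1" and bd: "\<And>z. norm z < 1 \<Longrightarrow> norm (f z) \<le> B"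
  obtains F where "continuous_on (cball 0 1) F" "\<And>z. norm z < 1 \<Longrightarrow> (F has_field_derivative f z) (at z)"
proof -
  obtain G where G: "\<And>z. z \<in> ball 0 1 \<Longrightarrow> (G has_field_derivative f z) (at z within ball 0 1)"
    using holomorphic_convex_primitive'[OF convex_ball open_ball f] by blast
  have Glip: "norm (G x - G y) \<le> B * norm (x - y)" if "x \<in> ball 0 1" "y \<in> ball 0 1" for x y
    by (rule field_differentiable_bound[OF convex_ball G]) (use bd that in auto)
  have B: "0 \<le> B" using order_trans[OF norm_ge_zero bd[of 0]] by simp
  have "uniformly_continuous_on (ball 0 1) G"
    unfolding uniformly_continuous_on_def
  proof (intro allI impI)
    fix e :: real assume e: "0 < e"
    show "\<exists>d>0. \<forall>x\<in>ball 0 1. \<forall>x'\<in>ball 0 1. dist x' x < d \<longrightarrow> dist (G x') (G x) < e"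
    proof (intro exI[of _ "e / (B + 1)"] conjI ballI impI)
      fix x x' :: complex assume x: "x \<in> ball 0 1" "x' \<in> ball 0 1" "dist x' x < e / (B + 1)"
      have "dist (G x') (G x) \<le> B * dist x' x" using Glip x by (simp add: dist_norm)
      also have "\<dots> \<le> (B + 1) * dist x' x" by (simp add: mult_right_mono)
      also have "\<dots> < e" using x B by (simp add: pos_less_divide_eq mult.commute)
      finally show "dist (G x') (G x) < e" .
    qed (use e B in simp)
  qed
  then obtain F where F: "uniformly_continuous_on (closure (ball 0 1)) F" "\<And>x. x \<in> ball 0 1 \<Longrightarrow> G x = F x"
    using uniformly_continuous_on_extension_on_closure by metis
  show thesis
  proof (rule that[of F])
    show "continuous_on (cball 0 1) F"
      using F(1) by (auto dest: uniformly_continuous_imp_continuous)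
    fix z :: complex assume z: "norm z < 1"
    have "(G has_field_derivative f z) (at z)"
      using G[of z] z by (simp add: at_within_open[OF _ open_ball])
    then show "(F has_field_derivative f z) (at z)"
      by (rule has_field_derivative_transform_within_open[of _ _ _ "ball 0 1"]) (use F z in auto)
  qed
qed

text \<open>Integrate f along arcs of the circles of radius \<rho> n and let n tend to infinity, using dominated
convergence.\<close>

lemma primitive_on_circle:
  fixes F f :: "complex \<Rightarrow> complex" and \<rho> :: "nat \<Rightarrow> real"
  assumes cont: "continuous_on (cball 0 1) F"
    and der: "\<And>z. norm z < 1 \<Longrightarrow> (F has_field_derivative f z) (at z)"
    and bd: "\<And>z. norm z < 1 \<Longrightarrow> norm (f z) \<le> B"
    and \<rho>: "\<And>n. 0 < \<rho> n" "\<And>n. \<rho> n < 1" "\<rho> \<longlonglongrightarrow> 1"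
    and h: "h \<in> borel_measurable circ" "AE \<theta> in circ. (\<lambda>n. f (of_real (\<rho> n) * cis \<theta>)) \<longlonglongrightarrow> h \<theta>"
    and b: "0 \<le> b" "b \<le> 2 * pi"
  shows "F (cis b) - F 1 = integral {0..b} (\<lambda>\<theta>. h \<theta> * (\<i> * cis \<theta>))"
proof -
  have hol: "f holomorphic_on ball 0 1"
  proof -
    have "F holomorphic_on ball 0 1" using der unfolding holomorphic_on_open[OF open_ball] by (metis dist_0_norm mem_ball)
    then have "deriv F holomorphic_on ball 0 1" by (rule holomorphic_deriv) simp
    then show ?thesis by (rule holomorphic_transform) (use der in \<open>auto intro: DERIV_imp_deriv\<close>)
  qed
  let ?u = "\<lambda>n \<theta>. f (of_real (\<rho> n) * cis \<theta>) * (of_real (\<rho> n) * (\<i> * cis \<theta>))"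
  have nr: "norm (of_real (\<rho> n) * cis \<theta>) < 1" for n \<theta> using \<rho>(1,2)[of n] by (simp add: norm_mult)
  have contu: "continuous_on A (?u n)" for A n
    using \<rho>(1,2)[of n] by (intro continuous_intros dilation_continuous hol) auto
  have hb [measurable]: "h \<in> borel_measurable (lebesgue_on {0..b})"
    by (rule measurable_restrict_mono[OF h(1)]) (use b in auto)
  have intu: "integrable (lebesgue_on {0..b}) (?u n)" for n
    by (rule continuous_imp_integrable_real[OF contu])
  have lim: "AE \<theta> in lebesgue_on {0..b}. (\<lambda>n. ?u n \<theta>) \<longlonglongrightarrow> h \<theta> * (of_real 1 * (\<i> * cis \<theta>))"
    using AE_circ_subinterval[OF h(2) b(2)]
    by eventually_elim (intro tendsto_intros \<rho>(3))
  have mc: "(\<lambda>\<theta>. h \<theta> * (of_real 1 * (\<i> * cis \<theta>))) \<in> borel_measurable (lebesgue_on {0..b})"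
  proof -
    have "(\<lambda>\<theta>. of_real 1 * (\<i> * cis \<theta>)) \<in> borel_measurable (lebesgue_on {0..b})"
      by (intro borel_measurable_integrable continuous_imp_integrable_real continuous_intros)
    then show ?thesis by measurable
  qed
  have B: "0 \<le> B" using order_trans[OF norm_ge_zero bd[of 0]] by simp
  have DC: "integrable (lebesgue_on {0..b}) (\<lambda>\<theta>. h \<theta> * (of_real 1 * (\<i> * cis \<theta>)))"
     "(\<lambda>n. LINT \<theta>|lebesgue_on {0..b}. ?u n \<theta>) \<longlonglongrightarrow> (LINT \<theta>|lebesgue_on {0..b}. h \<theta> * (of_real 1 * (\<i> * cis \<theta>)))"
  proof -
    have w: "integrable (lebesgue_on {0..b}) (\<lambda>_. B)" by (intro continuous_imp_integrable_real continuous_intros)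
    have le: "AE \<theta> in lebesgue_on {0..b}. norm (?u n \<theta>) \<le> B" for n
    proof (intro AE_I2)
      fix \<theta>
      have "norm (?u n \<theta>) = norm (f (of_real (\<rho> n) * cis \<theta>)) * \<rho> n" using \<rho>(1)[of n] by (simp add: norm_mult)
      also have "\<dots> \<le> B * 1" using bd[OF nr] \<rho>(1,2)[of n] B by (intro mult_mono) (auto intro: less_imp_le)
      finally show "norm (?u n \<theta>) \<le> B" by simp
    qed
    note dc = mc borel_measurable_integrable[OF intu] w lim le
    show "integrable (lebesgue_on {0..b}) (\<lambda>\<theta>. h \<theta> * (of_real 1 * (\<i> * cis \<theta>)))"
      by (rule integrable_dominated_convergence[OF dc])
    show "(\<lambda>n. LINT \<theta>|lebesgue_on {0..b}. ?u n \<theta>) \<longlonglongrightarrow> (LINT \<theta>|lebesgue_on {0..b}. h \<theta> * (of_real 1 * (\<i> * cis \<theta>)))"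
      by (rule integral_dominated_convergence[OF dc])
  qed
  have "(LINT \<theta>|lebesgue_on {0..b}. ?u n \<theta>) = F (of_real (\<rho> n) * cis b) - F (of_real (\<rho> n) * cis 0)" for n
  proof -
    have "(?u n has_integral (F (of_real (\<rho> n) * cis b) - F (of_real (\<rho> n) * cis 0))) {0..b}"
    proof (rule fundamental_theorem_of_calculus[OF b(1)])
      fix \<theta>
      have "((\<lambda>\<theta>. of_real (\<rho> n) * cis \<theta>) has_vector_derivative (of_real (\<rho> n) * (\<i> * cis \<theta>))) (at \<theta> within {0..b})"
        by (auto intro!: derivative_eq_intros simp: has_vector_derivative_def scaleR_conv_of_real mult_ac)
      from field_vector_diff_chain_within[OF this has_field_derivative_at_within[OF der[OF nr]]]
      show "((\<lambda>\<theta>. F (of_real (\<rho> n) * cis \<theta>)) has_vector_derivative ?u n \<theta>) (at \<theta> within {0..b})"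
        by (simp add: o_def mult_ac)
    qed
    then show ?thesis
      using has_integral_integral_lebesgue_on[OF intu[of n]] by (simp add: has_integral_unique)
  qed
  moreover have "(\<lambda>n. F (of_real (\<rho> n) * cis t)) \<longlonglongrightarrow> F (of_real 1 * cis t)" for t
  proof -
    have "(\<lambda>n. of_real (\<rho> n) * cis t) \<longlonglongrightarrow> of_real 1 * cis t"
      by (intro tendsto_intros \<rho>(3))
    then show ?thesis
    proof (rule continuous_on_tendsto_compose[OF cont])
      show "\<forall>\<^sub>F n in sequentially. of_real (\<rho> n) * cis t \<in> cball 0 1"
        using nr by (intro always_eventually allI) (simp add: less_imp_le)
    qed simp
  qed
  then have "(\<lambda>n. F (of_real (\<rho> n) * cis b) - F (of_real (\<rho> n) * cis 0)) \<longlonglongrightarrow> F (of_real 1 * cis b) - F (of_real 1 * cis 0)"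
    by (intro tendsto_diff)
  ultimately have "(LINT \<theta>|lebesgue_on {0..b}. h \<theta> * (of_real 1 * (\<i> * cis \<theta>))) = F (of_real 1 * cis b) - F (of_real 1 * cis 0)"
    using DC(2) LIMSEQ_unique by auto
  then show ?thesis
    using lebesgue_integral_eq_integral[OF DC(1)] by simp
qed

text \<open>Fatou's theorem for bounded functions: the tangential derivative of the primitive at angle \<theta> is
\<i> cis \<theta> h(\<theta>) for almost every \<theta>, and wherever it exists it forces the radial limit of f.\<close>

theorem Fatou_bounded:
  fixes f :: "complex \<Rightarrow> complex"
  assumes f: "f holomorphic_on ball 0 1" and bd: "\<And>z. norm z < 1 \<Longrightarrow> norm (f z) \<le> B"
  obtains h where "h \<in> borel_measurable circ"
    "AE \<theta> in circ. ((\<lambda>r. f (of_real r * cis \<theta>)) \<longlongrightarrow> h \<theta>) (at_left 1)"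
proof -
  obtain \<rho> :: "nat \<Rightarrow> real" and h where \<rho>: "\<And>n. 0 < \<rho> n" "\<And>n. \<rho> n < 1" "\<rho> \<longlonglongrightarrow> 1"
    and h: "h \<in> borel_measurable circ" "AE \<theta> in circ. (\<lambda>n. f (of_real (\<rho> n) * cis \<theta>)) \<longlonglongrightarrow> h \<theta>"
    using boundary_function_along_sequence[OF f bd] by blast
  obtain F where F: "continuous_on (cball 0 1) F" "\<And>z. norm z < 1 \<Longrightarrow> (F has_field_derivative f z) (at z)"
    using bounded_has_continuous_primitive[OF f bd] by blast
  \<comment> \<open>Extension by 0, so that k is integrable over every interval of the line.\<close>
  define k where "k \<theta> = (if \<theta> \<in> {0..2*pi} then h \<theta> * (\<i> * cis \<theta>) else 0)" for \<theta>
  have "AE \<theta> in circ. norm (h \<theta>) \<le> B"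
    using h(2)
  proof eventually_elim
    case (elim \<theta>)
    show ?case
      by (rule tendsto_upperbound[OF tendsto_norm[OF elim]])
         (use bd \<rho> in \<open>auto intro!: always_eventually bd simp: norm_mult abs_of_pos\<close>)
  qed
  moreover have mc: "(\<lambda>\<theta>. \<i> * cis \<theta>) \<in> borel_measurable circ"
    by (intro borel_measurable_integrable integrable_circ_continuous continuous_intros)
  ultimately have "integrable circ (\<lambda>\<theta>. h \<theta> * (\<i> * cis \<theta>))"
    by (intro finite_measure.integrable_const_bound[OF finite_measure_circ, of _ B])
       (use h(1) mc in \<open>auto simp: norm_mult\<close>)
  then have "(\<lambda>\<theta>. h \<theta> * (\<i> * cis \<theta>)) integrable_on {0..2*pi}"
    by (rule integrable_on_lebesgue_on) simp
  then have "k integrable_on UNIV"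
    unfolding k_def by (simp only: integrable_restrict_UNIV)
  then have "k integrable_on {a..b}" for a b
    by (rule integrable_on_subinterval) simp
  then obtain N where N: "negligible N"
    "\<And>x a. x \<notin> N \<Longrightarrow> a < x \<Longrightarrow> ((\<lambda>t. integral {a..t} k) has_vector_derivative k x) (at x)"
    using Lebesgue_differentiation[of k] by blast
  have "negligible (N \<union> {0, 2 * pi})" using N(1) by (simp add: negligible_insert)
  then have "AE \<theta> in lebesgue. \<theta> \<notin> N \<union> {0, 2 * pi}"
    by (intro AE_not_in) (simp only: negligible_iff_null_sets)
  then have "AE \<theta> in circ. \<theta> \<notin> N \<union> {0, 2 * pi}"
    by (subst AE_restrict_space_iff) auto
  then have "AE \<theta> in circ. ((\<lambda>r. f (of_real r * cis \<theta>)) \<longlongrightarrow> h \<theta>) (at_left 1)"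
  proof (rule AE_mp, intro AE_I2 impI)
    fix \<theta> assume "\<theta> \<in> space circ" and \<theta>N: "\<theta> \<notin> N \<union> {0, 2 * pi}"
    then have \<theta>: "0 < \<theta>" "\<theta> < 2 * pi" by auto
    have "((\<lambda>t. F 1 + integral {0..t} k) has_vector_derivative k \<theta>) (at \<theta>)"
      using N(2)[of \<theta> 0] \<theta>N \<theta> by (auto intro!: derivative_eq_intros)
    then have "((\<lambda>t. F (cis t)) has_vector_derivative k \<theta>) (at \<theta>)"
    proof (rule has_vector_derivative_transform_within_open[of _ _ _ "{0<..<2*pi}"])
      fix t assume t: "t \<in> {0<..<2*pi}"
      have "F (cis t) - F 1 = integral {0..t} (\<lambda>\<theta>. h \<theta> * (\<i> * cis \<theta>))"
        by (rule primitive_on_circle[OF F bd \<rho> h]) (use t in auto)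
      also have "\<dots> = integral {0..t} k"
        by (rule integral_cong) (use t in \<open>auto simp: k_def\<close>)
      finally show "F 1 + integral {0..t} k = F (cis t)" by (simp add: algebra_simps)
    qed (use \<theta> in auto)
    then have "((\<lambda>t. F (cis t)) has_vector_derivative h \<theta> * (\<i> * cis \<theta>)) (at \<theta>)"
      using \<theta> by (simp add: k_def)
    then show "((\<lambda>r. f (of_real r * cis \<theta>)) \<longlongrightarrow> h \<theta>) (at_left 1)"
      by (rule radial_limit_of_derivative[OF F(1), rotated]) (rule F(2))
  qed
  then show thesis using that h(1) by blast
qed

section \<open>Radial limits of functions with bounded means\<close>

text \<open>The Herglotz kernel is analytic in z with the Poisson kernel as its real part. It is the link
between Poisson integrals and analytic functions.\<close>

lemma Re_Herglotz_kernel: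
  assumes "norm z < 1"
  shows "Re ((cis \<theta> + z) / (cis \<theta> - z)) = poisson z \<theta>"
proof -
  have "Re ((cis \<theta> + z) * cnj (cis \<theta> - z)) = 1 - (norm z)\<^sup>2"
  proof -
    have "Re ((w + z) * cnj (w - z)) = (norm w)\<^sup>2 - (norm z)\<^sup>2" for w
      by (simp add: cmod_power2) (simp add: power2_eq_square algebra_simps)
    from this[of "cis \<theta>"] show ?thesis by (simp only: norm_cis power_one)
  qed
  then show ?thesis
    by (simp add: poisson_def complex_div_cnj[of _ "cis \<theta> - z"] flip: of_real_power)
qed

lemma Cauchy_transform_holomorphic:
  fixes g :: "complex \<Rightarrow> complex"
  assumes "continuous_on (sphere 0 1) g"
  shows "(\<lambda>z. LINT \<theta>|circ. g (cis \<theta>) * cis \<theta> / (cis \<theta> - z)) holomorphic_on ball 0 1"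
proof -
  let ?G = "\<lambda>z. contour_integral (circlepath 0 1) (\<lambda>u. g u / (u - z) ^ 1)"
  have cont: "continuous_on A (\<lambda>\<theta>. g (cis \<theta>))" for A
    by (rule continuous_on_compose2[OF assms]) (auto intro!: continuous_intros)
  have int: "((\<lambda>u. g u / (u - z) ^ 1) has_contour_integral ?G z) (circlepath 0 1)" if "z \<in> ball 0 1" for z
  proof -
    have "continuous_on (path_image (circlepath 0 1)) (\<lambda>u. g u / (u - z) ^ 1)"
      using that by (auto intro!: continuous_intros assms)
    then show ?thesis
      by (intro has_contour_integral_integral contour_integrable_continuous_circlepath)
  qed
  have "(?G has_field_derivative (of_nat 1 * contour_integral (circlepath 0 1) (\<lambda>u. g u / (u - z) ^ Suc 1))) (at z)"
    if "z \<in> ball 0 1" for z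
    by (rule Cauchy_next_derivative_circlepath(2)) (use assms int that in auto)
  then have "?G holomorphic_on ball 0 1"
    unfolding holomorphic_on_open[OF open_ball] by blast
  then have "(\<lambda>z. - \<i> * ?G z) holomorphic_on ball 0 1"
    by (intro holomorphic_intros)
  then show ?thesis
  proof (rule holomorphic_transform)
    fix z :: complex assume z: "z \<in> ball 0 1"
    then have "cis \<theta> - z \<noteq> 0" for \<theta> by auto
    then have "continuous_on {0..2*pi} (\<lambda>\<theta>. g (cis \<theta>) / (cis \<theta> - z) * cis \<theta>)"
      by (intro continuous_intros cont) auto
    then have "?G z = \<i> * (LINT \<theta>|circ. g (cis \<theta>) / (cis \<theta> - z) * cis \<theta>)"
      unfolding power_one_right by (intro contour_integral_unit_circle integrable_circ_continuous)
    then show "- \<i> * ?G z = (LINT \<theta>|circ. g (cis \<theta>) * cis \<theta> / (cis \<theta> - z))"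
      by (simp add: mult.assoc[symmetric] del: power_one_right)
  qed
qed

text \<open>Let S be the Herglotz integral of |f| on the circle of radius r, so that Re S is the Poisson integral
of |f|, and Re S(z) \<ge> |f(r z)| by the Poisson formula. The function H = 1/(1 + S) does the job: the
inequality |H - 1/2| \<le> 1/2 is equivalent to Re(1 + S) \<ge> 1, and the value of S at 0 is the
mean of |f|.\<close>

lemma denominator_for_dilation:
  fixes f :: "complex \<Rightarrow> complex"
  assumes f: "f holomorphic_on ball 0 1" and r: "0 < r" "r < 1"
    and bd: "(LINT \<theta>|circ. norm (f (of_real r * cis \<theta>))) \<le> 2 * pi * B"
  obtains H where "H holomorphic_on ball 0 1"
    "\<And>z. norm z < 1 \<Longrightarrow> norm (H z - 1/2) \<le> 1/2"
    "\<And>z. norm z < 1 \<Longrightarrow> norm (f (of_real r * z) * H z) \<le> 1"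
    "1 / (1 + B) \<le> Re (H 0)"
proof -
  let ?f = "\<lambda>z. f (of_real r * z)"
  have contf: "continuous_on (cball 0 1) ?f" by (rule dilation_cball) (use f r in auto)
  have contc: "continuous_on A (\<lambda>\<theta>. ?f (cis \<theta>))" for A by (rule dilation_continuous) (use f r in auto)
  define m where "m = (LINT \<theta>|circ. norm (?f (cis \<theta>)))"
  have m0: "0 \<le> m" unfolding m_def by (intro integral_nonneg_AE) simp
  define C where "C z = (LINT \<theta>|circ. of_real (norm (?f (cis \<theta>))) * cis \<theta> / (cis \<theta> - z))" for z
  \<comment> \<open>The Herglotz kernel is 2 cis \<theta> / (cis \<theta> - z) - 1, so the Herglotz integral is twice the Cauchy
    transform C minus the mean m.\<close>
  define F where "F z = 1 + (2 * C z - of_real m) / of_real (2 * pi)" for z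
  have "C holomorphic_on ball 0 1"
    unfolding C_def by (rule Cauchy_transform_holomorphic)
      (auto intro!: continuous_intros continuous_on_subset[OF contf])
  then have holF: "F holomorphic_on ball 0 1"
    unfolding F_def by (intro holomorphic_intros) auto
  have ReF: "1 + norm (?f z) \<le> Re (F z)" if z: "norm z < 1" for z
  proof -
    have nz: "cis \<theta> - z \<noteq> 0" for \<theta> using z by auto
    have i1: "integrable circ (\<lambda>\<theta>. of_real (norm (?f (cis \<theta>))) * cis \<theta> / (cis \<theta> - z))"
      by (intro integrable_circ_continuous continuous_intros contc) (use nz in auto)
    have i2: "integrable circ (\<lambda>\<theta>. complex_of_real (norm (?f (cis \<theta>))))"
      by (intro integrable_circ_continuous continuous_intros contc)
    have "2 * C z - of_real m = (LINT \<theta>|circ. 2 * (of_real (norm (?f (cis \<theta>))) * cis \<theta> / (cis \<theta> - z))) - (LINT \<theta>|circ. of_real (norm (?f (cis \<theta>))))"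
      unfolding C_def m_def by (simp only: integral_mult_right_zero integral_complex_of_real)
    also have "\<dots> = (LINT \<theta>|circ. 2 * (of_real (norm (?f (cis \<theta>))) * cis \<theta> / (cis \<theta> - z)) - of_real (norm (?f (cis \<theta>))))"
      by (intro Bochner_Integration.integral_diff[symmetric] integrable_mult_right i1 i2)
    also have "\<dots> = (LINT \<theta>|circ. of_real (norm (?f (cis \<theta>))) * ((cis \<theta> + z) / (cis \<theta> - z)))"
    proof (intro Bochner_Integration.integral_cong refl)
      fix \<theta>
      have *: "2 * (a * c / (c - z)) - a = a * ((c + z) / (c - z))" if "c - z \<noteq> 0" for a c
        using that by (simp add: field_simps)
      show "2 * (of_real (norm (?f (cis \<theta>))) * cis \<theta> / (cis \<theta> - z)) - of_real (norm (?f (cis \<theta>)))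
          = of_real (norm (?f (cis \<theta>))) * ((cis \<theta> + z) / (cis \<theta> - z))"
        by (rule *) (rule nz)
    qed
    finally have "Re (2 * C z - of_real m) = Re (LINT \<theta>|circ. of_real (norm (?f (cis \<theta>))) * ((cis \<theta> + z) / (cis \<theta> - z)))"
      by simp
    also have "\<dots> = (LINT \<theta>|circ. Re (of_real (norm (?f (cis \<theta>))) * ((cis \<theta> + z) / (cis \<theta> - z))))"
      by (intro integral_Re[symmetric] integrable_circ_continuous continuous_intros contc) (use nz in auto)
    also have "\<dots> = (LINT \<theta>|circ. norm (?f (cis \<theta>)) * poisson z \<theta>)"
      by (intro Bochner_Integration.integral_cong refl) (simp only: Re_Herglotz_kernel[OF z] times_complex.sel Re_complex_of_real Im_complex_of_real mult_zero_left diff_zero)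
    finally have 1: "Re (2 * C z - of_real m) = (LINT \<theta>|circ. norm (?f (cis \<theta>)) * poisson z \<theta>)" .
    have "2 * pi * norm (?f z) = norm (2 * pi * ?f z)" by (simp add: norm_mult)
    also have "2 * pi * ?f z = (LINT \<theta>|circ. ?f (cis \<theta>) * poisson z \<theta>)"
      using Poisson_mean[OF contf dilation_ball[OF f] z] r by simp
    also have "norm \<dots> \<le> (LINT \<theta>|circ. norm (?f (cis \<theta>) * poisson z \<theta>))"
      by (rule integral_norm_bound)
    also have "\<dots> = (LINT \<theta>|circ. norm (?f (cis \<theta>)) * poisson z \<theta>)"
      using poisson_nonneg[OF z] by (simp add: norm_mult)
    finally have "2 * pi * norm (?f z) \<le> Re (2 * C z - of_real m)" using 1 by simp
    then have "norm (?f z) \<le> Re (2 * C z - of_real m) / (2 * pi)"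
      by (simp add: pos_le_divide_eq mult.commute)
    also have "\<dots> = Re ((2 * C z - of_real m) / of_real (2 * pi))"
      by (rule Re_divide_of_real[symmetric])
    finally show ?thesis by (simp add: F_def)
  qed
  have F0: "F 0 = of_real (1 + m / (2 * pi))"
  proof -
    have "C 0 = (LINT \<theta>|circ. complex_of_real (norm (?f (cis \<theta>))))" unfolding C_def by simp
    also have "\<dots> = of_real m" unfolding m_def by (rule integral_complex_of_real)
    finally show ?thesis unfolding F_def by (simp add: field_simps)
  qed
  have Fnz: "F z \<noteq> 0" if "norm z < 1" for z
    using ReF[OF that] norm_ge_zero[of "?f z"] by (metis add_nonneg_pos less_le_not_le not_one_le_zero order_trans le_add_same_cancel1 zero_complex.simps(1))
  show thesis
  proof (rule that[of "\<lambda>z. 1 / F z"])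
    show "(\<lambda>z. 1 / F z) holomorphic_on ball 0 1"
      by (intro holomorphic_intros holF) (use Fnz in auto)
    fix z :: complex assume z: "norm z < 1"
    have nF: "0 < norm (F z)" using Fnz[OF z] by simp
    have "(norm (2 - F z))\<^sup>2 \<le> (norm (F z))\<^sup>2"
    proof -
      have "(norm (2 - F z))\<^sup>2 = (norm (F z))\<^sup>2 + 4 * (1 - Re (F z))"
        by (simp add: cmod_power2) (simp add: power2_eq_square algebra_simps)
      moreover have "1 - Re (F z) \<le> 0" using ReF[OF z] norm_ge_zero[of "?f z"] by linarith
      ultimately show ?thesis by simp
    qed
    then have "norm (2 - F z) \<le> norm (F z)" by (rule power2_le_imp_le) simp
    moreover have "1 / F z - 1/2 = (2 - F z) / (2 * F z)" using Fnz[OF z] by (simp add: field_simps)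
    ultimately show "norm (1 / F z - 1/2) \<le> 1/2"
      using nF by (simp add: norm_divide norm_mult field_simps)
    have "norm (?f z) \<le> norm (F z)"
      using ReF[OF z] complex_Re_le_cmod[of "F z"] by linarith
    then show "norm (?f z * (1 / F z)) \<le> 1"
      using nF by (simp add: norm_divide)
  next
    have "m / (2 * pi) \<le> B" using bd by (simp add: m_def field_simps)
    moreover have "0 \<le> m / (2 * pi)" using m0 by simp
    ultimately have "1 / (1 + B) \<le> 1 / (1 + m / (2 * pi))"
      by (intro divide_left_mono mult_pos_pos) auto
    also have "\<dots> = Re (1 / F 0)" unfolding F0 by (metis Re_complex_of_real of_real_1 of_real_divide)
    finally show "1 / (1 + B) \<le> Re (1 / F 0)" .
  qed
qed

text \<open>The denominators for the radii increasing to 1 form a normal family, and a subsequential limit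
inherits the inequalities. The lower bound at 0 prevents the limit from vanishing identically.
It vanishes nowhere, because at a zero |H - 1/2| would attain its maximum 1/2.\<close>

lemma bounded_quotient:
  fixes f :: "complex \<Rightarrow> complex"
  assumes f: "f holomorphic_on ball 0 1"
    and bd: "\<And>r. 0 < r \<Longrightarrow> r < 1 \<Longrightarrow> (LINT \<theta>|circ. norm (f (of_real r * cis \<theta>))) \<le> 2 * pi * B"
  obtains H where "H holomorphic_on ball 0 1"
    "\<And>z. norm z < 1 \<Longrightarrow> norm (H z - 1/2) \<le> 1/2"
    "\<And>z. norm z < 1 \<Longrightarrow> norm (f z * H z) \<le> 1"
    "\<And>z. norm z < 1 \<Longrightarrow> H z \<noteq> 0"
proof -
  have "\<exists>H. H holomorphic_on ball 0 1 \<and> (\<forall>z. norm z < 1 \<longrightarrow> norm (H z - 1/2) \<le> 1/2) \<and>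
      (\<forall>z. norm z < 1 \<longrightarrow> norm (f (of_real (radii n) * z) * H z) \<le> 1) \<and> 1 / (1 + B) \<le> Re (H 0)" for n
    using denominator_for_dilation[OF f radii bd[OF radii], of n] by metis
  then obtain H where H: "\<And>n. H n holomorphic_on ball 0 1" "\<And>n z. norm z < 1 \<Longrightarrow> norm (H n z - 1/2) \<le> 1/2"
      "\<And>n z. norm z < 1 \<Longrightarrow> norm (f (of_real (radii n) * z) * H n z) \<le> 1" "\<And>n. 1 / (1 + B) \<le> Re (H n 0)"
    by metis
  have H1: "norm (H n z) \<le> 1" if "norm z < 1" for n z
    using H(2)[OF that, of n] norm_triangle_sub[of "H n z" "1/2"] by simp
  obtain G k where G: "G holomorphic_on ball 0 1" "strict_mono (k :: nat \<Rightarrow> nat)"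
    "\<And>z. z \<in> ball 0 1 \<Longrightarrow> (\<lambda>n. H (k n) z) \<longlonglongrightarrow> G z"
  proof (rule Montel[of "ball 0 1" "range H" H])
    fix K :: "complex set" assume "compact K" "K \<subseteq> ball 0 1"
    then show "\<exists>B. \<forall>h\<in>range H. \<forall>z\<in>K. norm (h z) \<le> B"
      using H1 by (intro exI[of _ 1]) auto
  qed (use H(1) in auto)
  have G12: "norm (G z - 1/2) \<le> 1/2" if "norm z < 1" for z
    by (rule tendsto_upperbound[of "\<lambda>n. norm (H (k n) z - 1/2)" _ sequentially])
       (use that H(2) G(3) in \<open>auto intro!: tendsto_intros always_eventually\<close>)
  have fG: "norm (f z * G z) \<le> 1" if z: "norm z < 1" for z
  proof -
    have rk: "(\<lambda>n. radii (k n)) \<longlonglongrightarrow> 1"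
      using LIMSEQ_subseq_LIMSEQ[OF _ G(2), of radii 1] radii_at_left by (simp add: filterlim_at o_def)
    have "(\<lambda>n. f (of_real (radii (k n)) * z)) \<longlonglongrightarrow> f (of_real 1 * z)"
    proof (rule isCont_tendsto_compose[where g = f])
      show "isCont f (of_real 1 * z)"
        using holomorphic_on_imp_continuous_on[OF f] z by (simp add: continuous_on_eq_continuous_at)
      show "(\<lambda>n. of_real (radii (k n)) * z) \<longlonglongrightarrow> of_real 1 * z"
        by (intro tendsto_intros rk)
    qed
    then have "(\<lambda>n. norm (f (of_real (radii (k n)) * z) * H (k n) z)) \<longlonglongrightarrow> norm (f (of_real 1 * z) * G z)"
      using z by (intro tendsto_intros G(3)) auto
    then have "norm (f (of_real 1 * z) * G z) \<le> 1"
      by (rule tendsto_upperbound) (use H(3)[OF z] in auto)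
    then show ?thesis by simp
  qed
  have B: "0 < 1 / (1 + B)"
  proof -
    have "0 \<le> (LINT \<theta>|circ. norm (f (of_real (1/2) * cis \<theta>)))" by (intro integral_nonneg_AE) simp
    also have "\<dots> \<le> 2 * pi * B" by (rule bd) auto
    finally have "0 \<le> B" using mult_pos_neg[of "2 * pi" B] pi_gt_zero by force
    then show ?thesis by simp
  qed
  have ReG: "1 / (1 + B) \<le> Re (G 0)"
    by (rule tendsto_lowerbound[of "\<lambda>n. Re (H (k n) 0)" _ sequentially])
       (use G(3)[of 0] H(4) in \<open>auto intro!: tendsto_intros always_eventually\<close>)
  have "G z \<noteq> 0" if z: "norm z < 1" for z
  proof
    assume 0: "G z = 0"
    have "(\<lambda>z. G z - 1/2) constant_on ball 0 1"
    proof (rule maximum_modulus_principle[where U = "ball 0 1" and \<xi> = z])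
      show "norm (G w - 1/2) \<le> norm (G z - 1/2)" if "w \<in> ball 0 1" for w
        using G12[of w] that by (simp add: 0)
    qed (use z in \<open>auto intro!: holomorphic_intros G(1)\<close>)
    then obtain y where y: "\<And>w. w \<in> ball 0 1 \<Longrightarrow> G w - 1/2 = y"
      by (auto simp: constant_on_def)
    have "G 0 - 1/2 = G z - 1/2"
      using y[of 0] y[of z] z by simp
    then show False using ReG B 0 by simp
  qed
  with G(1) G12 fG show thesis using that by blast
qed

text \<open>The values of H lie in the closed disc about 1/2 of radius 1/2 and avoid 0, so L = - Ln H is
analytic with real part - ln |H| \<ge> 0. The means of Re L over circles all equal Re L(0). By Fatou's
lemma the lower limit of Re L along radii is finite almost everywhere, whereas it would be
infinite where H has radial limit 0.\<close>

lemma boundary_values_nonzero: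
  fixes H :: "complex \<Rightarrow> complex"
  assumes H: "H holomorphic_on ball 0 1" "\<And>z. norm z < 1 \<Longrightarrow> norm (H z - 1/2) \<le> 1/2"
    "\<And>z. norm z < 1 \<Longrightarrow> H z \<noteq> 0"
    and h: "AE \<theta> in circ. ((\<lambda>r. H (of_real r * cis \<theta>)) \<longlongrightarrow> h \<theta>) (at_left 1)"
  shows "AE \<theta> in circ. h \<theta> \<noteq> 0"
proof -
  have notneg: "H z \<notin> \<real>\<^sub>\<le>\<^sub>0" if z: "norm z < 1" for z
  proof
    assume "H z \<in> \<real>\<^sub>\<le>\<^sub>0"
    then obtain x where x: "H z = of_real x" "x \<le> 0" by (auto elim: nonpos_Reals_cases)
    have "Re (H z - 1/2) \<ge> - (1/2)"
      using H(2)[OF z] abs_Re_le_cmod[of "H z - 1/2"] by simp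
    then have "x = 0" using x by simp
    then show False using H(3)[OF z] x by simp
  qed
  define L where "L z = - Ln (H z)" for z
  have holL: "L holomorphic_on ball 0 1"
    unfolding L_def by (intro holomorphic_intros H(1)) (use notneg in auto)
  have ReL: "Re (L z) = - ln (norm (H z))" "0 \<le> Re (L z)" if z: "norm z < 1" for z
  proof -
    show 1: "Re (L z) = - ln (norm (H z))" using H(3)[OF z] by (simp add: L_def)
    have "norm (H z) \<le> 1" using H(2)[OF z] norm_triangle_sub[of "H z" "1/2"] by simp
    then show "0 \<le> Re (L z)" using H(3)[OF z] 1 by simp
  qed
  have intL: "integrable circ (\<lambda>\<theta>. L (of_real (radii n) * cis \<theta>))" for n
    using radii[of n] by (intro integrable_circ_continuous dilation_continuous holL) auto
  have eq: "(\<integral>\<^sup>+\<theta>. ennreal (Re (L (of_real (radii n) * cis \<theta>))) \<partial>circ) = ennreal (2 * pi * Re (L 0))" for n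
  proof -
    have "(\<integral>\<^sup>+\<theta>. ennreal (Re (L (of_real (radii n) * cis \<theta>))) \<partial>circ) = ennreal (LINT \<theta>|circ. Re (L (of_real (radii n) * cis \<theta>)))"
      using intL[of n] ReL(2)[OF norm_radii_less] by (intro nn_integral_eq_integral) auto
    also have "(LINT \<theta>|circ. Re (L (of_real (radii n) * cis \<theta>))) = Re (LINT \<theta>|circ. L (of_real (radii n) * cis \<theta>))"
      using intL by (rule integral_Re)
    also have "(LINT \<theta>|circ. L (of_real (radii n) * cis \<theta>)) = 2 * pi * L 0"
      using mean_value_circ[OF dilation_cball[OF holL] dilation_ball[OF holL], of "radii n"] radii[of n] by simp
    finally show ?thesis by simp
  qed
  let ?l = "\<lambda>\<theta>. liminf (\<lambda>n. ennreal (Re (L (of_real (radii n) * cis \<theta>))))"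
  have mL: "(\<lambda>\<theta>. ennreal (Re (L (of_real (radii n) * cis \<theta>)))) \<in> borel_measurable circ" for n
    using intL[of n] by measurable
  have "(\<integral>\<^sup>+\<theta>. ?l \<theta> \<partial>circ) \<le> liminf (\<lambda>n. \<integral>\<^sup>+\<theta>. ennreal (Re (L (of_real (radii n) * cis \<theta>))) \<partial>circ)"
    by (rule nn_integral_liminf[OF mL])
  also have "\<dots> = ennreal (2 * pi * Re (L 0))"
    unfolding eq by (rule lim_imp_Liminf) auto
  finally have "(\<integral>\<^sup>+\<theta>. ?l \<theta> \<partial>circ) \<noteq> \<infinity>" by (auto simp: top_unique)
  moreover have "?l \<in> borel_measurable circ" using mL by measurable
  ultimately have "AE \<theta> in circ. ?l \<theta> \<noteq> \<infinity>"
    by (intro nn_integral_PInf_AE)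
  with h show ?thesis
  proof eventually_elim
    case (elim \<theta>)
    show ?case
    proof
      assume "h \<theta> = 0"
      then have "(\<lambda>n. H (of_real (radii n) * cis \<theta>)) \<longlonglongrightarrow> 0"
        using filterlim_compose[OF elim(1) radii_at_left] by simp
      then have "(\<lambda>n. norm (H (of_real (radii n) * cis \<theta>))) \<longlonglongrightarrow> 0"
        by (rule tendsto_norm_zero)
      then have "filterlim (\<lambda>n. norm (H (of_real (radii n) * cis \<theta>))) (at_right 0) sequentially"
        unfolding filterlim_at using H(3)[OF norm_radii_less] by (auto intro!: always_eventually)
      then have "filterlim (\<lambda>n. ln (norm (H (of_real (radii n) * cis \<theta>)))) at_bot sequentially"
        by (rule filterlim_compose[OF ln_at_0])
      then have "filterlim (\<lambda>n. Re (L (of_real (radii n) * cis \<theta>))) at_top sequentially"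
        unfolding ReL(1)[OF norm_radii_less] by (simp only: filterlim_uminus_at_bot)
      then have "(\<lambda>n. ennreal (Re (L (of_real (radii n) * cis \<theta>)))) \<longlonglongrightarrow> \<infinity>"
        by (simp add: ennreal_tendsto_top_eq_at_top)
      then have "?l \<theta> = \<infinity>" by (intro lim_imp_Liminf) auto
      with elim(2) show False by simp
    qed
  qed
qed

text \<open>Fatou's theorem for functions with bounded means: write f = (f H)/H and apply the bounded case
to numerator and denominator.\<close>

theorem Fatou_L1_means:
  fixes f :: "complex \<Rightarrow> complex"
  assumes f: "f holomorphic_on ball 0 1"
    and bd: "\<And>r. 0 < r \<Longrightarrow> r < 1 \<Longrightarrow> (LINT \<theta>|circ. norm (f (of_real r * cis \<theta>))) \<le> 2 * pi * B"
  obtains h where "h \<in> borel_measurable circ"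
    "AE \<theta> in circ. ((\<lambda>r. f (of_real r * cis \<theta>)) \<longlongrightarrow> h \<theta>) (at_left 1)"
proof -
  obtain H where H: "H holomorphic_on ball 0 1"
    "\<And>z. norm z < 1 \<Longrightarrow> norm (H z - 1/2) \<le> 1/2"
    "\<And>z. norm z < 1 \<Longrightarrow> norm (f z * H z) \<le> 1"
    "\<And>z. norm z < 1 \<Longrightarrow> H z \<noteq> 0"
    using bounded_quotient[OF f bd] by blast
  have H1: "norm (H z) \<le> 1" if "norm z < 1" for z
    using H(2)[OF that] norm_triangle_sub[of "H z" "1/2"] by simp
  obtain u where u: "u \<in> borel_measurable circ" "AE \<theta> in circ. ((\<lambda>r. H (of_real r * cis \<theta>)) \<longlongrightarrow> u \<theta>) (at_left 1)"
    using Fatou_bounded[OF H(1) H1] by blast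
  have "(\<lambda>z. f z * H z) holomorphic_on ball 0 1" by (intro holomorphic_intros f H(1))
  from Fatou_bounded[OF this H(3)] obtain v where v: "v \<in> borel_measurable circ"
    "AE \<theta> in circ. ((\<lambda>r. f (of_real r * cis \<theta>) * H (of_real r * cis \<theta>)) \<longlongrightarrow> v \<theta>) (at_left 1)"
    by blast
  have "AE \<theta> in circ. u \<theta> \<noteq> 0"
    by (rule boundary_values_nonzero[OF H(1,2,4) u(2)])
  with u(2) v(2) have "AE \<theta> in circ. ((\<lambda>r. f (of_real r * cis \<theta>)) \<longlongrightarrow> v \<theta> / u \<theta>) (at_left 1)"
  proof eventually_elim
    case (elim \<theta>)
    have "((\<lambda>r. f (of_real r * cis \<theta>) * H (of_real r * cis \<theta>) / H (of_real r * cis \<theta>)) \<longlongrightarrow> v \<theta> / u \<theta>) (at_left 1)"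
      by (intro tendsto_divide elim)
    moreover have "\<forall>\<^sub>F r in at_left (1::real). f (of_real r * cis \<theta>) * H (of_real r * cis \<theta>) / H (of_real r * cis \<theta>) = f (of_real r * cis \<theta>)"
    proof (rule eventually_at_leftI[of 0])
      fix r :: real assume "r \<in> {0<..<1}"
      then have "norm (of_real r * cis \<theta>) < 1" by (simp add: norm_mult)
      then show "f (of_real r * cis \<theta>) * H (of_real r * cis \<theta>) / H (of_real r * cis \<theta>) = f (of_real r * cis \<theta>)"
        using H(4) by simp
    qed simp
    ultimately show ?case by (rule Lim_transform_eventually)
  qed
  moreover have "(\<lambda>\<theta>. v \<theta> / u \<theta>) \<in> borel_measurable circ" using u(1) v(1) by measurable
  ultimately show thesis using that by blast
qed

section \<open>Inner functions and the pairing on the circle\<close>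

text \<open>The mean value property survives in the limit: the mean of the boundary function is the value at
the centre.\<close>

lemma bounded_boundary_mean:
  fixes f :: "complex \<Rightarrow> complex"
  assumes f: "f holomorphic_on ball 0 1" and bd: "\<And>z. norm z < 1 \<Longrightarrow> norm (f z) \<le> B"
  obtains h where "h \<in> borel_measurable circ" "integrable circ h"
    "AE \<theta> in circ. ((\<lambda>r. f (of_real r * cis \<theta>)) \<longlongrightarrow> h \<theta>) (at_left 1)"
    "AE \<theta> in circ. norm (h \<theta>) \<le> B"
    "(LINT \<theta>|circ. h \<theta>) = 2 * pi * f 0"
proof -
  obtain h where h [measurable]: "h \<in> borel_measurable circ"
    and lim: "AE \<theta> in circ. ((\<lambda>r. f (of_real r * cis \<theta>)) \<longlongrightarrow> h \<theta>) (at_left 1)"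
    using Fatou_bounded[OF f bd] by blast
  have lim': "AE \<theta> in circ. (\<lambda>n. f (of_real (radii n) * cis \<theta>)) \<longlonglongrightarrow> h \<theta>"
    using lim by eventually_elim (rule filterlim_compose[OF _ radii_at_left])
  have int: "integrable circ (\<lambda>\<theta>. f (of_real (radii n) * cis \<theta>))" for n
    using radii[of n] by (intro integrable_circ_continuous dilation_continuous f) auto
  have hB: "AE \<theta> in circ. norm (h \<theta>) \<le> B"
    using lim'
  proof eventually_elim
    case (elim \<theta>)
    show ?case
      by (rule tendsto_upperbound[OF tendsto_norm[OF elim]])
         (auto intro!: always_eventually bd norm_radii_less)
  qed
  have inth: "integrable circ h"
    by (rule finite_measure.integrable_const_bound[OF finite_measure_circ hB h])
  have "(\<lambda>n. LINT \<theta>|circ. f (of_real (radii n) * cis \<theta>)) \<longlonglongrightarrow> (LINT \<theta>|circ. h \<theta>)"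
    by (rule integral_dominated_convergence[where w = "\<lambda>_. B"])
       (use lim' int in \<open>auto intro!: bd norm_radii_less integrable_circ_continuous\<close>)
  moreover have "(LINT \<theta>|circ. f (of_real (radii n) * cis \<theta>)) = 2 * pi * f 0" for n
    using mean_value_circ[OF dilation_cball[OF f] dilation_ball[OF f], of "radii n"] radii[of n] by simp
  ultimately have "(LINT \<theta>|circ. h \<theta>) = 2 * pi * f 0"
    using LIMSEQ_unique tendsto_const by (metis (no_types, lifting) ext)
  then show thesis using that[OF h inth lim hB] by blast
qed

lemma boundary_value_eq:
  assumes "((\<lambda>r. f (of_real r * cis \<theta>)) \<longlongrightarrow> l) (at_left 1)"
  shows "boundary_value f (cis \<theta>) = l"
  unfolding boundary_value_def using assms by (intro tendsto_Lim) auto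

text \<open>The definition of an inner function gives the bound 1 only on the boundary, and inside the disc
merely some bound. The bound 1 inside the disc follows from the Poisson formula in the limit,
because the Poisson kernel has mean 1.\<close>

lemma inner_boundary:
  fixes J :: "complex \<Rightarrow> complex"
  assumes "inner_function J"
  obtains j where "J holomorphic_on ball 0 1" "\<And>z. norm z < 1 \<Longrightarrow> norm (J z) \<le> 1"
    "j \<in> borel_measurable circ"
    "AE \<theta> in circ. ((\<lambda>r. J (of_real r * cis \<theta>)) \<longlongrightarrow> j \<theta>) (at_left 1)"
    "AE \<theta> in circ. norm (j \<theta>) = 1"
    "integrable circ j" "(LINT \<theta>|circ. j \<theta>) = 2 * pi * J 0"
proof -
  have hol: "J holomorphic_on ball 0 1" and "bounded (J ` ball 0 1)"
    using assms by (auto simp: inner_function_def hardy_space_inf_def)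
  then obtain B where "\<forall>x\<in>J ` ball 0 1. norm x \<le> B"
    by (auto simp: bounded_iff)
  then have B: "norm (J z) \<le> B" if "norm z < 1" for z using that by simp
  obtain j where j: "j \<in> borel_measurable circ" "integrable circ j"
    "AE \<theta> in circ. ((\<lambda>r. J (of_real r * cis \<theta>)) \<longlongrightarrow> j \<theta>) (at_left 1)"
    "(LINT \<theta>|circ. j \<theta>) = 2 * pi * J 0"
    using bounded_boundary_mean[OF hol B] by blast
  have "AE \<theta> in circ. norm (boundary_value J (cis \<theta>)) = 1"
    using assms by (simp add: inner_function_def)
  with j(3) have j1: "AE \<theta> in circ. norm (j \<theta>) = 1"
    by eventually_elim (simp add: boundary_value_eq)
  have le: "norm (J z) \<le> 1" if z: "norm z < 1" for z
  proof -
    have cP: "continuous_on A (poisson z)" for A by (rule continuous_on_poisson[OF z])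
    let ?P = "\<lambda>n. LINT \<theta>|circ. J (of_real (radii n) * cis \<theta>) * poisson z \<theta>"
    have mP [measurable]: "poisson z \<in> borel_measurable circ"
      by (intro borel_measurable_integrable integrable_circ_continuous cP)
    have "?P \<longlonglongrightarrow> (LINT \<theta>|circ. j \<theta> * poisson z \<theta>)"
    proof (rule integral_dominated_convergence[where w = "\<lambda>\<theta>. B * poisson z \<theta>"])
      show "(\<lambda>\<theta>. j \<theta> * complex_of_real (poisson z \<theta>)) \<in> borel_measurable circ"
        using j(1) by measurable
      show "(\<lambda>\<theta>. J (of_real (radii n) * cis \<theta>) * poisson z \<theta>) \<in> borel_measurable circ" for n
        using radii[of n] by (intro borel_measurable_integrable integrable_circ_continuous continuous_intros cP dilation_continuous hol) auto
      show "integrable circ (\<lambda>\<theta>. B * poisson z \<theta>)"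
        by (intro integrable_circ_continuous continuous_intros cP)
      show "AE \<theta> in circ. (\<lambda>n. J (of_real (radii n) * cis \<theta>) * poisson z \<theta>) \<longlonglongrightarrow> j \<theta> * poisson z \<theta>"
        using j(3) by eventually_elim (intro tendsto_intros filterlim_compose[OF _ radii_at_left])
      show "AE \<theta> in circ. norm (J (of_real (radii n) * cis \<theta>) * poisson z \<theta>) \<le> B * poisson z \<theta>" for n
        using poisson_nonneg[OF z] B[OF norm_radii_less] by (intro AE_I2) (simp add: norm_mult mult_right_mono)
    qed
    moreover have "?P n = 2 * pi * J (of_real (radii n) * z)" for n
      using Poisson_mean[OF dilation_cball[OF hol] dilation_ball[OF hol] z, of "radii n"] radii[of n] by simp
    moreover have "(\<lambda>n. 2 * pi * J (of_real (radii n) * z)) \<longlonglongrightarrow> 2 * pi * J (of_real 1 * z)"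
    proof -
      have "radii \<longlonglongrightarrow> 1" using radii_at_left by (simp add: filterlim_at)
      then have "(\<lambda>n. of_real (radii n) * z) \<longlonglongrightarrow> of_real 1 * z" by (intro tendsto_intros)
      moreover have "isCont J (of_real 1 * z)"
        using holomorphic_on_imp_continuous_on[OF hol] z by (simp add: continuous_on_eq_continuous_at)
      ultimately show ?thesis by (intro tendsto_mult_left isCont_tendsto_compose[where g = J])
    qed
    ultimately have "2 * pi * J z = (LINT \<theta>|circ. j \<theta> * poisson z \<theta>)"
      using LIMSEQ_unique by (metis (no_types, lifting) ext mult_1 of_real_1)
    from arg_cong[OF this, of norm]
    have "2 * pi * norm (J z) = norm (LINT \<theta>|circ. j \<theta> * poisson z \<theta>)"
      by (simp add: norm_mult)
    also have "\<dots> \<le> (LINT \<theta>|circ. norm (j \<theta> * poisson z \<theta>))"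
      by (rule integral_norm_bound)
    also have "\<dots> = (LINT \<theta>|circ. poisson z \<theta>)"
    proof (rule integral_cong_AE)
      show "AE \<theta> in circ. norm (j \<theta> * poisson z \<theta>) = poisson z \<theta>"
        using j1 by eventually_elim (use poisson_nonneg[OF z] in \<open>simp add: norm_mult\<close>)
    qed (use j(1) in measurable)
    also have "\<dots> = 2 * pi"
    proof -
      have "complex_of_real (LINT \<theta>|circ. poisson z \<theta>) = (LINT \<theta>|circ. of_real (poisson z \<theta>))"
        by (rule integral_complex_of_real[symmetric])
      also have "\<dots> = of_real (2 * pi)"
        using Poisson_mean[of "\<lambda>_. 1" z] z by simp
      finally show ?thesis by (simp only: of_real_eq_iff)
    qed
    finally show ?thesis by simp
  qed
  show thesis by (rule that[OF hol le j(1,3) j1 j(2,4)])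
qed

text \<open>A Henstock-Kurzweil integral ignores negligible sets, so the contour integral can be computed from
any integrable y that agrees with the integrand almost everywhere. In particular the points where
boundary values fail to exist do not matter.\<close>

lemma contour_integral_unit_circle_AE:
  assumes "AE \<theta> in circ. f (cis \<theta>) * cis \<theta> = y \<theta>" "integrable circ y"
  shows "1 / (2 * of_real pi * \<i>) * contour_integral (circlepath 0 1) f = (LINT \<theta>|circ. y \<theta>) / (2 * pi)"
proof -
  obtain N where N: "negligible N" "\<And>\<theta>. \<theta> \<in> {0..2*pi} - N \<Longrightarrow> f (cis \<theta>) * cis \<theta> = y \<theta>"
  proof -
    have "AE \<theta> in lebesgue. \<theta> \<in> {0..2*pi} \<longrightarrow> f (cis \<theta>) * cis \<theta> = y \<theta>"
      using assms(1) by (simp add: AE_restrict_space_iff)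
    then obtain N where "N \<in> null_sets lebesgue" "{\<theta>. \<not> (\<theta> \<in> {0..2*pi} \<longrightarrow> f (cis \<theta>) * cis \<theta> = y \<theta>)} \<subseteq> N"
      by (auto simp: eventually_ae_filter)
    then show thesis using that[of N] by (auto simp: negligible_iff_null_sets)
  qed
  have "contour_integral (circlepath 0 1) f = integral {0..2*pi} (\<lambda>t. f (0 + complex_of_real 1 * cis t) * complex_of_real 1 * \<i> * cis t)"
    unfolding circlepath_def by (rule contour_integral_part_circlepath_eq) auto
  also have "\<dots> = integral {0..2*pi} (\<lambda>t. \<i> * y t)"
  proof (rule integral_spike[OF N(1)])
    fix t assume "t \<in> {0..2*pi} - N"
    from N(2)[OF this] show "\<i> * y t = f (0 + complex_of_real 1 * cis t) * complex_of_real 1 * \<i> * cis t"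
      by (simp add: mult_ac)
  qed
  also have "\<dots> = (LINT t|circ. \<i> * y t)"
    using assms(2) by (intro lebesgue_integral_eq_integral[symmetric] integrable_mult_right) auto
  also have "\<dots> = \<i> * (LINT t|circ. y t)" by simp
  finally show ?thesis by simp
qed

section \<open>The upper bound for the pairing\<close>

lemma Re_one_minus_cnj_mult_pos:
  assumes "norm c < 1" "norm w \<le> 1"
  shows "0 < Re (1 - cnj c * w)"
proof -
  have "norm (cnj c * w) \<le> norm c * 1"
    unfolding norm_mult complex_mod_cnj using assms by (intro mult_left_mono) auto
  then show ?thesis using complex_Re_le_cmod[of "cnj c * w"] assms by simp
qed

text \<open>The power is 1 at w = 0, so its difference quotient \<psi> at 0 is analytic wherever the power is,
namely on a half plane that contains the closed unit disc.\<close>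

lemma power_factor:
  fixes c :: complex and \<beta> :: real
  assumes c: "norm c < 1"
  obtains \<psi> M where "\<psi> holomorphic_on cball 0 1" "\<And>w. norm w \<le> 1 \<Longrightarrow> norm (\<psi> w) \<le> M"
    "\<And>w. norm w \<le> 1 \<Longrightarrow> (1 - cnj c * w) powr of_real \<beta> = 1 + w * \<psi> w"
proof -
  define U where "U = {w. 0 < Re (1 - cnj c * w)}"
  have "open U" unfolding U_def by (intro open_Collect_less continuous_intros)
  have sub: "cball 0 1 \<subseteq> U"
    using Re_one_minus_cnj_mult_pos[OF c] by (auto simp: U_def)
  let ?K = "\<lambda>w. (1 - cnj c * w) powr of_real \<beta>"
  have "?K holomorphic_on U"
    by (intro holomorphic_intros) (auto simp: U_def complex_nonpos_Reals_iff)
  then have hol: "(\<lambda>z. if z = 0 then deriv ?K 0 else (?K z - ?K 0) / (z - 0)) holomorphic_on U"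
    by (rule pole_lemma_open) (rule \<open>open U\<close>)
  define \<psi> where "\<psi> z = (if z = 0 then deriv ?K 0 else (?K z - ?K 0) / (z - 0))" for z
  have holc: "\<psi> holomorphic_on cball 0 1"
    unfolding \<psi>_def by (rule holomorphic_on_subset[OF hol sub])
  then have "bounded (\<psi> ` cball 0 1)"
    by (intro compact_imp_bounded compact_continuous_image holomorphic_on_imp_continuous_on compact_cball)
  then obtain M where "\<And>w. norm w \<le> 1 \<Longrightarrow> norm (\<psi> w) \<le> M" by (force simp: bounded_iff)
  moreover have "?K w = 1 + w * \<psi> w" for w by (simp add: \<psi>_def)
  ultimately show thesis using holc that by blast
qed

lemma norm_one_minus_squared:
  fixes c w :: complex
  shows "(norm (1 - cnj c * w))\<^sup>2 = 1 + (norm c)\<^sup>2 * (norm w)\<^sup>2 - 2 * Re (cnj c * w)"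
proof -
  have "(norm (1 - u))\<^sup>2 = 1 + (norm u)\<^sup>2 - 2 * Re u" for u :: complex
    by (simp add: cmod_power2) (simp add: power2_eq_square algebra_simps)
  from this[of "cnj c * w"] show ?thesis by (simp add: norm_mult power_mult_distrib)
qed

lemma circle_mean_nonneg: "0 \<le> circle_mean q g r"
  unfolding circle_mean_def
  by (cases "(\<lambda>\<theta>. norm (g (of_real r * cis \<theta>)) powr q) integrable_on {0..2*pi}")
     (auto intro!: divide_nonneg_pos integral_nonneg simp: not_integrable_integral)

lemma hardy_ball_means:
  assumes q: "1 < q" and g: "g \<in> hardy_space q" "hardy_norm q g \<le> 1" and r: "0 < r" "r < 1"
  shows "(LINT \<theta>|circ. norm (g (of_real r * cis \<theta>)) powr q) \<le> 2 * pi"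
proof -
  have hol: "g holomorphic_on ball 0 1" and bdd: "bdd_above (circle_mean q g ` {0<..<1})"
    using g(1) by (auto simp: hardy_space_def)
  define S where "S = (SUP r\<in>{0<..<1}. circle_mean q g r)"
  have le: "circle_mean q g r \<le> S" unfolding S_def using r by (intro cSUP_upper bdd) auto
  then have "0 \<le> S" using circle_mean_nonneg[of q g r] by linarith
  then have "S = (S powr (1 / q)) powr q" using q by (simp add: powr_powr)
  also have "\<dots> \<le> 1 powr q" using g(2) q by (intro powr_mono2) (auto simp: hardy_norm_def S_def)
  finally have "circle_mean q g r \<le> 1" using le by simp
  moreover have "(LINT \<theta>|circ. norm (g (of_real r * cis \<theta>)) powr q) = integral {0..2*pi} (\<lambda>\<theta>. norm (g (of_real r * cis \<theta>)) powr q)"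
    using r q by (intro lebesgue_integral_eq_integral integrable_circ_continuous continuous_on_powr' continuous_intros dilation_continuous hol) auto
  ultimately show ?thesis by (simp add: circle_mean_def pos_divide_le_eq)
qed

text \<open>The boundary function of z g(z) \<psi>(J(z)) has mean 0, since it is the limit of means of an analytic
function vanishing at 0. Adding it to the pairing changes the boundary function paired with gb from
cnj j to cnj j * (1 - cnj c * j)^(2/p), to which Young's inequality, scaled by N, applies.\<close>

lemma pairing_upper_bound:
  fixes J g :: "complex \<Rightarrow> complex"
  assumes q: "1 < q" and J: "inner_function J" and c: "norm (J 0) < 1"
    and g: "g \<in> hardy_space q" "hardy_norm q g \<le> 1"
  shows "norm (1 / (2 * of_real pi * \<i>) * contour_integral (circlepath 0 1)
            (\<lambda>\<zeta>. boundary_value g \<zeta> * cnj (boundary_value J \<zeta>))) \<le> (1 - (norm (J 0))\<^sup>2) powr (1 - 1 / q)"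
proof -
  define c where "c = J 0"
  have c1: "norm c < 1" using c by (simp add: c_def)
  define p where "p = q / (q - 1)"
  have p: "1 < p" "1 / q + 1 / p = 1" "1 - 1 / q = 1 / p" using q by (auto simp: p_def field_simps)
  define N where "N = (1 - (norm c)\<^sup>2) powr (1 / p)"
  have pos: "0 < 1 - (norm c)\<^sup>2" using c1 by (simp add: abs_square_less_1)
  have N: "0 < N" "N powr p = 1 - (norm c)\<^sup>2" using pos p by (auto simp: N_def powr_powr)
  have holg: "g holomorphic_on ball 0 1" using g(1) by (simp add: hardy_space_def)
  obtain j where holJ: "J holomorphic_on ball 0 1" and J1: "\<And>z. norm z < 1 \<Longrightarrow> norm (J z) \<le> 1"
    and j [measurable]: "j \<in> borel_measurable circ"
    and jlim: "AE \<theta> in circ. ((\<lambda>r. J (of_real r * cis \<theta>)) \<longlongrightarrow> j \<theta>) (at_left 1)"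
    and j1: "AE \<theta> in circ. norm (j \<theta>) = 1"
    and jint: "integrable circ j" "(LINT \<theta>|circ. j \<theta>) = 2 * pi * c"
    using inner_boundary[OF J] unfolding c_def by blast
  have le: "t \<le> 1 + t powr q" if "0 \<le> t" for t :: real
    using q that by (intro le_one_plus_powr) auto
  have contg: "continuous_on A (\<lambda>\<theta>. g (of_real r * cis \<theta>))" if "0 < r" "r < 1" for r A
    using that by (intro dilation_continuous holg) auto
  have contq: "continuous_on A (\<lambda>\<theta>. norm (g (of_real r * cis \<theta>)) powr q)" if "0 < r" "r < 1" for r A
    using q by (intro continuous_on_powr' continuous_intros contg that) auto
  have gL1: "(LINT \<theta>|circ. norm (g (of_real r * cis \<theta>))) \<le> 2 * pi * 2" if r: "0 < r" "r < 1" for r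
  proof -
    have "(LINT \<theta>|circ. norm (g (of_real r * cis \<theta>))) \<le> (LINT \<theta>|circ. 1 + norm (g (of_real r * cis \<theta>)) powr q)"
      using r by (intro integral_mono integrable_circ_continuous continuous_intros contg contq le) auto
    also have "\<dots> = (LINT \<theta>|circ. 1) + (LINT \<theta>|circ. norm (g (of_real r * cis \<theta>)) powr q)"
      using r by (intro Bochner_Integration.integral_add integrable_circ_continuous continuous_intros contq) auto
    also have "\<dots> \<le> 2 * pi + 2 * pi"
      using hardy_ball_means[OF q g r] measure_circ by simp
    finally show ?thesis by simp
  qed
  obtain gb where gb [measurable]: "gb \<in> borel_measurable circ"
    and glim: "AE \<theta> in circ. ((\<lambda>r. g (of_real r * cis \<theta>)) \<longlongrightarrow> gb \<theta>) (at_left 1)"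
    using Fatou_L1_means[OF holg gL1] by blast
  have G: "integrable circ (\<lambda>\<theta>. norm (gb \<theta>) powr q)" "(LINT \<theta>|circ. norm (gb \<theta>) powr q) \<le> 2 * pi" "integrable circ gb"
  proof -
    let ?X = "\<lambda>n \<theta>. g (of_real (radii n) * cis \<theta>)"
    have 1: "?X n \<in> borel_measurable circ" for n
      using radii[of n] by (intro borel_measurable_integrable integrable_circ_continuous contg)
    have 2: "integrable circ (\<lambda>\<theta>. norm (?X n \<theta>) powr q)" for n
      using radii[of n] by (intro integrable_circ_continuous contq)
    have 3: "(LINT \<theta>|circ. norm (?X n \<theta>) powr q) \<le> 2 * pi" for n
      by (rule hardy_ball_means[OF q g radii])
    have 4: "AE \<theta> in circ. (\<lambda>n. ?X n \<theta>) \<longlonglongrightarrow> gb \<theta>"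
      using glim by eventually_elim (rule filterlim_compose[OF _ radii_at_left])
    note L = integral_limit_of_Lq_bounded[OF finite_measure_circ q 1 gb 2 3 4]
    show "integrable circ (\<lambda>\<theta>. norm (gb \<theta>) powr q)" "(LINT \<theta>|circ. norm (gb \<theta>) powr q) \<le> 2 * pi" "integrable circ gb"
      using L(1-3) by auto
  qed
  obtain \<psi> M where psi: "\<psi> holomorphic_on cball 0 1" "\<And>w. norm w \<le> 1 \<Longrightarrow> norm (\<psi> w) \<le> M"
    "\<And>w. norm w \<le> 1 \<Longrightarrow> (1 - cnj c * w) powr of_real (2 / p) = 1 + w * \<psi> w"
    using power_factor[OF c1, of "2 / p"] by blast
  have M: "0 \<le> M" by (rule order_trans[OF norm_ge_zero psi(2)[of 0]]) simp
  have hpsi: "(\<lambda>z. \<psi> (J z)) holomorphic_on ball 0 1"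
  proof -
    have "J ` ball 0 1 \<subseteq> cball 0 1" using J1 by auto
    from holomorphic_on_compose_gen[OF holJ psi(1) this] show ?thesis by (simp add: o_def)
  qed
  obtain \<phi> where phi [measurable]: "\<phi> \<in> borel_measurable circ"
    and philim: "AE \<theta> in circ. ((\<lambda>r. \<psi> (J (of_real r * cis \<theta>))) \<longlongrightarrow> \<phi> \<theta>) (at_left 1)"
    using Fatou_bounded[OF hpsi] psi(2) J1 by blast
  have phij: "AE \<theta> in circ. \<phi> \<theta> = \<psi> (j \<theta>)"
    using jlim philim j1
  proof eventually_elim
    case (elim \<theta>)
    have "((\<lambda>r. \<psi> (J (of_real r * cis \<theta>))) \<longlongrightarrow> \<psi> (j \<theta>)) (at_left 1)"
    proof (rule continuous_on_tendsto_compose[OF holomorphic_on_imp_continuous_on[OF psi(1)] elim(1)])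
      show "\<forall>\<^sub>F r in at_left (1::real). J (of_real r * cis \<theta>) \<in> cball 0 1"
        by (rule eventually_at_leftI[of 0]) (auto intro!: J1 simp: norm_mult)
    qed (use elim in simp)
    with elim(2) show ?case by (rule tendsto_unique[rotated]) simp
  qed
  have phiM: "AE \<theta> in circ. norm (\<phi> \<theta>) \<le> M"
    using phij j1 by eventually_elim (simp add: psi(2))
  have mcis [measurable]: "cis \<in> borel_measurable circ"
    by (intro borel_measurable_integrable integrable_circ_continuous continuous_intros)
  have mcj [measurable]: "(\<lambda>\<theta>. cnj (j \<theta>)) \<in> borel_measurable circ"
    using jint(1) by (intro borel_measurable_integrable) simp
  \<comment> \<open>The correction has mean 0: its analytic extension has mean 0 over inner circles, and its q-th
    power means stay bounded because \<psi>(J) is bounded.\<close>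
  have orth: "integrable circ (\<lambda>\<theta>. gb \<theta> * cis \<theta> * \<phi> \<theta>)" "(LINT \<theta>|circ. gb \<theta> * cis \<theta> * \<phi> \<theta>) = 0"
  proof -
    let ?X = "\<lambda>n \<theta>. g (of_real (radii n) * cis \<theta>) * cis \<theta> * \<psi> (J (of_real (radii n) * cis \<theta>))"
    have cX: "continuous_on A (?X n)" for A n
      using radii[of n] by (intro continuous_intros contg dilation_continuous[OF hpsi]) auto
    have 1: "?X n \<in> borel_measurable circ" for n
      by (intro borel_measurable_integrable integrable_circ_continuous cX)
    have m: "(\<lambda>\<theta>. gb \<theta> * cis \<theta> * \<phi> \<theta>) \<in> borel_measurable circ" by measurable
    have 2: "integrable circ (\<lambda>\<theta>. norm (?X n \<theta>) powr q)" for n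
      using q by (intro integrable_circ_continuous continuous_on_powr' continuous_intros cX) auto
    have 3: "(LINT \<theta>|circ. norm (?X n \<theta>) powr q) \<le> M powr q * (2 * pi)" for n
    proof -
      have "(LINT \<theta>|circ. norm (?X n \<theta>) powr q) \<le> (LINT \<theta>|circ. M powr q * norm (g (of_real (radii n) * cis \<theta>)) powr q)"
      proof (rule integral_mono[OF 2])
        show "integrable circ (\<lambda>\<theta>. M powr q * norm (g (of_real (radii n) * cis \<theta>)) powr q)"
          using radii[of n] by (intro integrable_circ_continuous continuous_on_mult_left contq)
        fix \<theta>
        have "norm (?X n \<theta>) = norm (\<psi> (J (of_real (radii n) * cis \<theta>))) * norm (g (of_real (radii n) * cis \<theta>))"
          by (simp add: norm_mult)
        also have "\<dots> \<le> M * norm (g (of_real (radii n) * cis \<theta>))"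
          by (intro mult_right_mono psi(2) J1 norm_radii_less norm_ge_zero)
        finally have "norm (?X n \<theta>) powr q \<le> (M * norm (g (of_real (radii n) * cis \<theta>))) powr q"
          using q by (intro powr_mono2) auto
        then show "norm (?X n \<theta>) powr q \<le> M powr q * norm (g (of_real (radii n) * cis \<theta>)) powr q"
          using M by (simp add: powr_mult)
      qed
      also have "\<dots> = M powr q * (LINT \<theta>|circ. norm (g (of_real (radii n) * cis \<theta>)) powr q)" by simp
      also have "\<dots> \<le> M powr q * (2 * pi)"
        by (intro mult_left_mono hardy_ball_means[OF q g radii]) auto
      finally show ?thesis .
    qed
    have 4: "AE \<theta> in circ. (\<lambda>n. ?X n \<theta>) \<longlonglongrightarrow> gb \<theta> * cis \<theta> * \<phi> \<theta>"
      using glim philim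
      by eventually_elim (intro tendsto_intros filterlim_compose[OF _ radii_at_left])
    note L = integral_limit_of_Lq_bounded[OF finite_measure_circ q 1 m 2 3 4]
    show "integrable circ (\<lambda>\<theta>. gb \<theta> * cis \<theta> * \<phi> \<theta>)" by (rule L(3))
    have "(LINT \<theta>|circ. ?X n \<theta>) = 0" for n
    proof -
      let ?f = "\<lambda>z. g z * z * \<psi> (J z)"
      have "?f holomorphic_on ball 0 1" by (intro holomorphic_intros holg hpsi)
      note f = this
      have "of_real (radii n) * (LINT \<theta>|circ. ?X n \<theta>) = (LINT \<theta>|circ. ?f (of_real (radii n) * cis \<theta>))"
        unfolding integral_mult_right_zero[symmetric] by (simp add: mult_ac)
      also have "\<dots> = 2 * pi * ?f (of_real (radii n) * 0)"
        by (rule mean_value_circ[OF dilation_cball[OF f] dilation_ball[OF f]]) (use radii[of n] in auto)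
      finally show ?thesis using radii[of n] by simp
    qed
    then have "(\<lambda>n. 0) \<longlonglongrightarrow> (LINT \<theta>|circ. gb \<theta> * cis \<theta> * \<phi> \<theta>)"
      using L(4) by (simp only:)
    then show "(LINT \<theta>|circ. gb \<theta> * cis \<theta> * \<phi> \<theta>) = 0"
      by (rule LIMSEQ_unique[OF _ tendsto_const])
  qed
  have inty: "integrable circ (\<lambda>\<theta>. gb \<theta> * cnj (j \<theta>) * cis \<theta>)"
  proof (rule Bochner_Integration.integrable_bound[OF G(3)])
    show "AE \<theta> in circ. norm (gb \<theta> * cnj (j \<theta>) * cis \<theta>) \<le> norm (gb \<theta>)"
      using j1 by eventually_elim (simp add: norm_mult)
  qed measurable
  have eq: "1 / (2 * of_real pi * \<i>) * contour_integral (circlepath 0 1)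
            (\<lambda>\<zeta>. boundary_value g \<zeta> * cnj (boundary_value J \<zeta>)) = (LINT \<theta>|circ. gb \<theta> * cnj (j \<theta>) * cis \<theta>) / (2 * pi)"
  proof (rule contour_integral_unit_circle_AE[OF _ inty])
    show "AE \<theta> in circ. boundary_value g (cis \<theta>) * cnj (boundary_value J (cis \<theta>)) * cis \<theta> = gb \<theta> * cnj (j \<theta>) * cis \<theta>"
      using glim jlim by eventually_elim (simp add: boundary_value_eq)
  qed
  let ?k = "\<lambda>\<theta>. norm (1 - cnj c * j \<theta>)"
  have k2: "integrable circ (\<lambda>\<theta>. (?k \<theta>)\<^sup>2)" "(LINT \<theta>|circ. (?k \<theta>)\<^sup>2) = 2 * pi * (1 - (norm c)\<^sup>2)"
  proof -
    let ?w = "\<lambda>\<theta>. 1 + (norm c)\<^sup>2 - 2 * Re (cnj c * j \<theta>)"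
    have ae: "AE \<theta> in circ. ?w \<theta> = (?k \<theta>)\<^sup>2"
      using j1 by eventually_elim (simp only: norm_one_minus_squared, simp)
    have ij: "integrable circ (\<lambda>\<theta>. Re (cnj c * j \<theta>))" using jint(1) by (intro integrable_Re integrable_mult_right)
    have i1: "integrable circ (\<lambda>\<theta>. 1 + (norm c)\<^sup>2)" by (intro integrable_circ_continuous continuous_intros)
    have iw: "integrable circ ?w"
      using ij i1 by (intro Bochner_Integration.integrable_diff integrable_mult_right)
    show "integrable circ (\<lambda>\<theta>. (?k \<theta>)\<^sup>2)"
      by (rule integrable_cong_AE_imp[OF iw _ ae]) measurable
    have "(LINT \<theta>|circ. (?k \<theta>)\<^sup>2) = (LINT \<theta>|circ. ?w \<theta>)"
      by (rule integral_cong_AE[symmetric, OF _ _ ae]) measurable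
    also have "\<dots> = (LINT \<theta>|circ. 1 + (norm c)\<^sup>2) - (LINT \<theta>|circ. 2 * Re (cnj c * j \<theta>))"
      using ij i1 by (intro Bochner_Integration.integral_diff integrable_mult_right)
    also have "(LINT \<theta>|circ. 2 * Re (cnj c * j \<theta>)) = 2 * Re (LINT \<theta>|circ. cnj c * j \<theta>)"
      using jint(1) by (subst integral_Re[symmetric]) auto
    also have "(LINT \<theta>|circ. cnj c * j \<theta>) = cnj c * (2 * pi * c)"
      using jint(2) by simp
    also have "Re (cnj c * (2 * pi * c)) = 2 * pi * (norm c)\<^sup>2"
      by (simp add: cmod_power2) (simp add: power2_eq_square algebra_simps)
    also have "(LINT \<theta>|circ. 1 + (norm c)\<^sup>2) = 2 * pi * (1 + (norm c)\<^sup>2)"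
      using measure_circ by simp
    finally show "(LINT \<theta>|circ. (?k \<theta>)\<^sup>2) = 2 * pi * (1 - (norm c)\<^sup>2)" by (simp add: algebra_simps)
  qed
  have "(LINT \<theta>|circ. gb \<theta> * cnj (j \<theta>) * cis \<theta>) = (LINT \<theta>|circ. gb \<theta> * cnj (j \<theta>) * cis \<theta> + gb \<theta> * cis \<theta> * \<phi> \<theta>)"
    using inty orth by simp
  also have "norm \<dots> \<le> (LINT \<theta>|circ. norm (gb \<theta> * cnj (j \<theta>) * cis \<theta> + gb \<theta> * cis \<theta> * \<phi> \<theta>))"
    by (rule integral_norm_bound)
  also have "\<dots> \<le> (LINT \<theta>|circ. N * (norm (gb \<theta>) powr q / q + (?k \<theta>)\<^sup>2 / (1 - (norm c)\<^sup>2) / p))"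
  proof (rule integral_mono_AE)
    show "integrable circ (\<lambda>\<theta>. norm (gb \<theta> * cnj (j \<theta>) * cis \<theta> + gb \<theta> * cis \<theta> * \<phi> \<theta>))"
      using inty orth by auto
    show "integrable circ (\<lambda>\<theta>. N * (norm (gb \<theta>) powr q / q + (?k \<theta>)\<^sup>2 / (1 - (norm c)\<^sup>2) / p))"
      using G(1) k2(1) by auto
    show "AE \<theta> in circ. norm (gb \<theta> * cnj (j \<theta>) * cis \<theta> + gb \<theta> * cis \<theta> * \<phi> \<theta>)
        \<le> N * (norm (gb \<theta>) powr q / q + (?k \<theta>)\<^sup>2 / (1 - (norm c)\<^sup>2) / p)"
      using j1 phij
    proof eventually_elim
      case (elim \<theta>)
      have jj: "cnj (j \<theta>) * j \<theta> = 1" using elim(1) complex_norm_square[of "j \<theta>"] by (simp add: mult.commute)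
      have "gb \<theta> * cnj (j \<theta>) * cis \<theta> + gb \<theta> * cis \<theta> * \<phi> \<theta> = gb \<theta> * cis \<theta> * (cnj (j \<theta>) + (cnj (j \<theta>) * j \<theta>) * \<psi> (j \<theta>))"
        unfolding jj elim(2) by (simp add: algebra_simps)
      also have "\<dots> = gb \<theta> * cis \<theta> * (cnj (j \<theta>) * (1 + j \<theta> * \<psi> (j \<theta>)))"
        by (simp add: algebra_simps)
      also have "1 + j \<theta> * \<psi> (j \<theta>) = (1 - cnj c * j \<theta>) powr of_real (2 / p)"
        using psi(3) elim(1) by simp
      also have "norm (gb \<theta> * cis \<theta> * (cnj (j \<theta>) * (1 - cnj c * j \<theta>) powr of_real (2 / p))) = norm (gb \<theta>) * ?k \<theta> powr (2 / p)"
        using elim(1) by (simp add: norm_mult norm_powr_real_powr')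
      also have "\<dots> = N * (norm (gb \<theta>) * (?k \<theta> powr (2 / p) / N))" using N by simp
      also have "\<dots> \<le> N * (norm (gb \<theta>) powr q / q + (?k \<theta> powr (2 / p) / N) powr p / p)"
        using N p q by (intro mult_left_mono Youngs_inequality) auto
      also have "(?k \<theta> powr (2 / p) / N) powr p = (?k \<theta>)\<^sup>2 / (1 - (norm c)\<^sup>2)"
        using N p by (simp add: powr_divide powr_powr powr_numeral)
      finally show ?case .
    qed
  qed
  also have "\<dots> = N * ((LINT \<theta>|circ. norm (gb \<theta>) powr q) / q + (LINT \<theta>|circ. (?k \<theta>)\<^sup>2) / (1 - (norm c)\<^sup>2) / p)"
    using G(1) k2(1) by simp
  also have "\<dots> \<le> N * (2 * pi / q + 2 * pi / p)"
    unfolding k2(2) using G(2) q p(1) N(1) pos by (intro mult_left_mono add_mono divide_right_mono) auto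
  also have "\<dots> = N * (2 * pi) * (1 / q + 1 / p)" by (simp add: algebra_simps)
  also have "\<dots> = N * (2 * pi)" unfolding p(2) by simp
  finally have "norm (LINT \<theta>|circ. gb \<theta> * cnj (j \<theta>) * cis \<theta>) \<le> N * (2 * pi)" .
  then have "norm ((LINT \<theta>|circ. gb \<theta> * cnj (j \<theta>) * cis \<theta>) / (2 * pi)) \<le> N"
    by (simp add: norm_divide pos_divide_le_eq)
  then show ?thesis unfolding eq N_def p(3) c_def .
qed

section \<open>An extremal function\<close>

lemma nonconstant_disc_map_less:
  fixes J :: "complex \<Rightarrow> complex"
  assumes hol: "J holomorphic_on ball 0 1" and le: "\<And>z. norm z < 1 \<Longrightarrow> norm (J z) \<le> 1"
    and nc: "\<not> J constant_on ball 0 1" and z: "norm z < 1"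
  shows "norm (J z) < 1"
proof (rule ccontr)
  assume "\<not> norm (J z) < 1"
  then have "J constant_on ball 0 1"
    using z by (intro maximum_modulus_principle[OF hol, where U = "ball 0 1" and \<xi> = z])
      (auto intro: order_trans[OF le])
  with nc show False by contradiction
qed

text \<open>The function g = h k^(2/q) / N, where h(z) = b(z)/z and k = 1 - cnj c * J, is extremal. By the
Schwarz lemma |h| \<le> 1, so |g|^q \<le> |k|^2/(1 - |c|^2), which has mean at most 1 over every circle.
On the boundary |h| = 1, and the pairing can be evaluated because its integrand
cnj j (j - c) k^(2/q-1) / N is a linear combination of boundary values of analytic functions and their
conjugates. The general K serves the product of two boundary values, which agrees with the
boundary value of the product only almost everywhere.\<close>

lemma pairing_attained:
  fixes J :: "complex \<Rightarrow> complex"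
  assumes q: "1 < q" and J: "inner_function J" and c: "norm (J 0) < 1"
  obtains g where "g \<in> hardy_space q" "hardy_norm q g \<le> 1"
    "\<And>K. AE \<theta> in circ. ((\<lambda>r. J (of_real r * cis \<theta>)) \<longlongrightarrow> K (cis \<theta>)) (at_left 1) \<Longrightarrow>
       norm (1 / (2 * of_real pi * \<i>) * contour_integral (circlepath 0 1)
            (\<lambda>\<zeta>. boundary_value g \<zeta> * cnj (K \<zeta>))) = (1 - (norm (J 0))\<^sup>2) powr (1 - 1 / q)"
proof -
  define c where "c = J 0"
  have c1: "norm c < 1" using c by (simp add: c_def)
  have pos: "0 < 1 - (norm c)\<^sup>2" using c1 by (simp add: abs_square_less_1)
  obtain j where holJ: "J holomorphic_on ball 0 1" and J1: "\<And>z. norm z < 1 \<Longrightarrow> norm (J z) \<le> 1"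
    and jlim: "AE \<theta> in circ. ((\<lambda>r. J (of_real r * cis \<theta>)) \<longlongrightarrow> j \<theta>) (at_left 1)"
    and j1: "AE \<theta> in circ. norm (j \<theta>) = 1"
    and jint: "integrable circ j" "(LINT \<theta>|circ. j \<theta>) = 2 * pi * c"
    using inner_boundary[OF J] unfolding c_def by blast
  have Jlt: "norm (J z) < 1" if z: "norm z < 1" for z
  proof (cases "J constant_on ball 0 1")
    case True
    then obtain y where y: "\<And>w. w \<in> ball 0 1 \<Longrightarrow> J w = y" by (auto simp: constant_on_def)
    then show ?thesis using y[of z] y[of 0] z c by simp
  qed (use nonconstant_disc_map_less[OF holJ J1 _ z] in blast)
  have Rek: "0 < Re (1 - cnj c * w)" if "norm w \<le> 1" for w
    using Re_one_minus_cnj_mult_pos[OF c1 that] .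
  have knz: "1 - cnj c * w \<noteq> 0" if "norm w \<le> 1" for w
    using Rek[OF that] by (metis less_irrefl zero_complex.simps(1))
  define b where "b z = (J z - c) / (1 - cnj c * J z)" for z
  have holb: "b holomorphic_on ball 0 1"
    unfolding b_def by (intro holomorphic_intros holJ) (use knz J1 in auto)
  have b0: "b 0 = 0" by (simp add: b_def c_def)
  have b1: "norm (b z) < 1" if z: "norm z < 1" for z
  proof -
    have eq: "(norm (1 - cnj c * J z))\<^sup>2 - (norm (J z - c))\<^sup>2 = (1 - (norm c)\<^sup>2) * (1 - (norm (J z))\<^sup>2)"
    proof -
      have "(norm (J z - c))\<^sup>2 = (norm (J z))\<^sup>2 + (norm c)\<^sup>2 - 2 * Re (cnj c * J z)"
        by (simp add: cmod_power2) (simp add: power2_eq_square algebra_simps)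
      then show ?thesis unfolding norm_one_minus_squared by (simp only:) (simp only: algebra_simps)
    qed
    have "0 < 1 - (norm (J z))\<^sup>2" using Jlt[OF z] by (simp add: abs_square_less_1)
    then have "0 < (1 - (norm c)\<^sup>2) * (1 - (norm (J z))\<^sup>2)" using pos by (rule mult_pos_pos[rotated])
    then have "(norm (J z - c))\<^sup>2 < (norm (1 - cnj c * J z))\<^sup>2" unfolding eq[symmetric] by (simp only: diff_gt_0_iff_gt)
    then have "norm (J z - c) < norm (1 - cnj c * J z)" by (rule power2_less_imp_less) (rule norm_ge_zero)
    then show ?thesis using knz[OF J1[OF z]] by (simp add: b_def norm_divide)
  qed
  obtain h where h: "h holomorphic_on ball 0 1" "\<And>z. norm z < 1 \<Longrightarrow> b z = z * h z" "deriv b 0 = h 0"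
    using Schwarz3[OF holb b0] by blast
  have h1: "norm (h z) \<le> 1" if z: "norm z < 1" for z
  proof (cases "z = 0")
    case True
    then show ?thesis using Schwarz_Lemma(2)[OF holb b0 b1 z] h(3) by simp
  next
    case False
    have "norm z * norm (h z) \<le> norm z * 1"
      using Schwarz_Lemma(1)[OF holb b0 b1 z] h(2)[OF z] by (simp add: norm_mult)
    then show ?thesis using False by (simp only: mult_le_cancel_left_pos zero_less_norm_iff not_False_eq_True)
  qed
  define N where "N = (1 - (norm c)\<^sup>2) powr (1 / q)"
  have N: "0 < N" "N powr q = 1 - (norm c)\<^sup>2" using pos q by (auto simp: N_def powr_powr)
  define g where "g z = h z * (1 - cnj c * J z) powr of_real (2 / q) / of_real N" for z
  have holg: "g holomorphic_on ball 0 1"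
    unfolding g_def using N Rek J1
    by (intro holomorphic_intros h(1) holJ) (auto simp: complex_nonpos_Reals_iff not_le)
  have gq: "norm (g z) powr q \<le> (norm (1 - cnj c * J z))\<^sup>2 / (1 - (norm c)\<^sup>2)" if z: "norm z < 1" for z
  proof -
    have "norm (g z) = norm (h z) * (norm (1 - cnj c * J z) powr (2 / q) / N)"
      using N by (simp add: g_def norm_mult norm_divide norm_powr_real_powr')
    also have "\<dots> \<le> 1 * (norm (1 - cnj c * J z) powr (2 / q) / N)"
      using h1[OF z] N by (intro mult_right_mono) auto
    finally have "norm (g z) powr q \<le> (norm (1 - cnj c * J z) powr (2 / q) / N) powr q"
      using q by (intro powr_mono2) auto
    also have "\<dots> = (norm (1 - cnj c * J z))\<^sup>2 / (1 - (norm c)\<^sup>2)"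
      using N q knz[OF J1[OF z]] by (simp add: powr_divide powr_powr powr_numeral)
    finally show ?thesis .
  qed
  have mean_le: "circle_mean q g r \<le> 1" if r: "r \<in> {0<..<1}" for r
  proof -
    have nr: "norm (of_real r * cis \<theta>) < 1" for \<theta> using r by (simp add: norm_mult)
    have r': "0 \<le> r" "r < 1" using r by auto
    let ?J = "\<lambda>\<theta>. J (of_real r * cis \<theta>)"
    have cJ: "continuous_on A ?J" for A by (rule dilation_continuous[OF holJ r'])
    have cg: "continuous_on A (\<lambda>\<theta>. norm (g (of_real r * cis \<theta>)) powr q)" for A
      using q by (intro continuous_on_powr' continuous_intros dilation_continuous[OF holg r']) auto
    have "2 * pi * circle_mean q g r = (LINT \<theta>|circ. norm (g (of_real r * cis \<theta>)) powr q)"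
      unfolding circle_mean_def
      by (subst lebesgue_integral_eq_integral) (auto intro!: integrable_circ_continuous cg)
    also have "\<dots> \<le> (LINT \<theta>|circ. (1 + (norm c)\<^sup>2 - 2 * Re (cnj c * ?J \<theta>)) / (1 - (norm c)\<^sup>2))"
    proof (rule integral_mono)
      show "integrable circ (\<lambda>\<theta>. norm (g (of_real r * cis \<theta>)) powr q)"
        by (intro integrable_circ_continuous cg)
      show "integrable circ (\<lambda>\<theta>. (1 + (norm c)\<^sup>2 - 2 * Re (cnj c * ?J \<theta>)) / (1 - (norm c)\<^sup>2))"
        using pos by (intro integrable_circ_continuous continuous_intros cJ) auto
      fix \<theta>
      have "(norm c)\<^sup>2 * (norm (?J \<theta>))\<^sup>2 \<le> (norm c)\<^sup>2 * 1"
        using J1[OF nr] by (intro mult_left_mono) (auto simp: abs_square_le_1)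
      then have "(norm (1 - cnj c * ?J \<theta>))\<^sup>2 \<le> 1 + (norm c)\<^sup>2 - 2 * Re (cnj c * ?J \<theta>)"
        unfolding norm_one_minus_squared by simp
      then have "(norm (1 - cnj c * ?J \<theta>))\<^sup>2 / (1 - (norm c)\<^sup>2) \<le> (1 + (norm c)\<^sup>2 - 2 * Re (cnj c * ?J \<theta>)) / (1 - (norm c)\<^sup>2)"
        using pos by (intro divide_right_mono) auto
      then show "norm (g (of_real r * cis \<theta>)) powr q \<le> (1 + (norm c)\<^sup>2 - 2 * Re (cnj c * ?J \<theta>)) / (1 - (norm c)\<^sup>2)"
        using gq[OF nr] order_trans by blast
    qed
    also have "\<dots> = ((LINT \<theta>|circ. 1 + (norm c)\<^sup>2) - (LINT \<theta>|circ. 2 * Re (cnj c * ?J \<theta>))) / (1 - (norm c)\<^sup>2)"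
      unfolding integral_divide_zero
      by (subst Bochner_Integration.integral_diff) (auto intro!: integrable_circ_continuous continuous_intros cJ)
    also have "(LINT \<theta>|circ. 2 * Re (cnj c * ?J \<theta>)) = 2 * Re (LINT \<theta>|circ. cnj c * ?J \<theta>)"
      unfolding integral_mult_right_zero
      by (subst integral_Re) (auto intro!: integrable_circ_continuous continuous_intros cJ)
    also have "(LINT \<theta>|circ. cnj c * ?J \<theta>) = cnj c * (2 * pi * c)"
      using mean_value_circ[OF dilation_cball[OF holJ r'] dilation_ball[OF holJ r']] by (simp add: c_def)
    also have "Re (cnj c * (2 * pi * c)) = 2 * pi * (norm c)\<^sup>2"
      by (simp add: cmod_power2) (simp add: power2_eq_square algebra_simps)
    also have "(LINT \<theta>|circ. 1 + (norm c)\<^sup>2) = 2 * pi * (1 + (norm c)\<^sup>2)"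
      using measure_circ by simp
    also have "(2 * pi * (1 + (norm c)\<^sup>2) - 2 * (2 * pi * (norm c)\<^sup>2)) / (1 - (norm c)\<^sup>2) = 2 * pi"
    proof -
      have "2 * pi * (1 + (norm c)\<^sup>2) - 2 * (2 * pi * (norm c)\<^sup>2) = 2 * pi * (1 - (norm c)\<^sup>2)"
        by (simp add: algebra_simps)
      then show ?thesis using pos by simp
    qed
    finally show ?thesis by simp
  qed
  have gH: "g \<in> hardy_space q"
    unfolding hardy_space_def using holg mean_le by (auto intro!: bdd_aboveI2[of _ _ 1])
  have "(SUP r\<in>{0<..<1}. circle_mean q g r) powr (1 / q) \<le> 1 powr (1 / q)"
  proof (rule powr_mono2)
    show le: "(SUP r\<in>{0<..<1}. circle_mean q g r) \<le> 1"
      by (rule cSUP_least) (use mean_le in auto)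
    have "0 \<le> circle_mean q g (1/2)" by (rule circle_mean_nonneg)
    also have "\<dots> \<le> (SUP r\<in>{0<..<1}. circle_mean q g r)"
      by (rule cSUP_upper) (use mean_le in \<open>auto intro!: bdd_aboveI2[of _ _ 1]\<close>)
    finally show "0 \<le> (SUP r\<in>{0<..<1}. circle_mean q g r)" .
  qed (use q in auto)
  then have gn: "hardy_norm q g \<le> 1" by (simp add: hardy_norm_def)
  \<comment> \<open>On the circle b k^(2/q) = (j - c) k^\<beta>, and k^\<beta> = 1 + j \<psi>(j).\<close>
  define \<beta> where "\<beta> = 2 / q - 1"
  obtain \<psi> M where psi: "\<psi> holomorphic_on cball 0 1" "\<And>w. norm w \<le> 1 \<Longrightarrow> norm (\<psi> w) \<le> M"
    "\<And>w. norm w \<le> 1 \<Longrightarrow> (1 - cnj c * w) powr of_real \<beta> = 1 + w * \<psi> w"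
    using power_factor[OF c1, of \<beta>] by blast
  have hpsi: "(\<lambda>z. \<psi> (J z)) holomorphic_on ball 0 1"
  proof -
    have "J ` ball 0 1 \<subseteq> cball 0 1" using J1 by auto
    from holomorphic_on_compose_gen[OF holJ psi(1) this] show ?thesis by (simp add: o_def)
  qed
  have psiM: "norm (\<psi> (J z)) \<le> M" if "norm z < 1" for z using that by (intro psi(2) J1)
  have hjpsi: "(\<lambda>z. J z * \<psi> (J z)) holomorphic_on ball 0 1" by (intro holomorphic_intros holJ hpsi)
  have jpsiM: "norm (J z * \<psi> (J z)) \<le> 1 * M" if "norm z < 1" for z
    unfolding norm_mult using that J1 psiM by (intro mult_mono) auto
  obtain \<phi> where phi: "integrable circ \<phi>" "(LINT \<theta>|circ. \<phi> \<theta>) = 2 * pi * \<psi> (J 0)"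
    and philim: "AE \<theta> in circ. ((\<lambda>r. \<psi> (J (of_real r * cis \<theta>))) \<longlongrightarrow> \<phi> \<theta>) (at_left 1)"
    using bounded_boundary_mean[OF hpsi psiM] by blast
  obtain \<phi>' where phi': "integrable circ \<phi>'" "(LINT \<theta>|circ. \<phi>' \<theta>) = 2 * pi * (J 0 * \<psi> (J 0))"
    and philim': "AE \<theta> in circ. ((\<lambda>r. J (of_real r * cis \<theta>) * \<psi> (J (of_real r * cis \<theta>))) \<longlongrightarrow> \<phi>' \<theta>) (at_left 1)"
    using bounded_boundary_mean[OF hjpsi jpsiM] by blast
  define y where "y \<theta> = (1 + \<phi>' \<theta> - c * cnj (j \<theta>) - c * \<phi> \<theta>) / of_real N" for \<theta>
  have i1: "integrable circ (\<lambda>\<theta>. 1 :: complex)" by (intro integrable_circ_continuous continuous_intros)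
  have inty: "integrable circ y"
    unfolding y_def using phi(1) phi'(1) jint(1) i1 by auto
  have vy: "(LINT \<theta>|circ. y \<theta>) = 2 * pi * ((1 - (norm c)\<^sup>2) / of_real N)"
  proof -
    have "(LINT \<theta>|circ. y \<theta>) = ((LINT \<theta>|circ. 1) + (LINT \<theta>|circ. \<phi>' \<theta>) - c * cnj (LINT \<theta>|circ. j \<theta>) - c * (LINT \<theta>|circ. \<phi> \<theta>)) / of_real N"
      unfolding y_def using phi(1) phi'(1) jint(1) i1 by simp
    also have "(LINT \<theta>|circ. 1) = complex_of_real (2 * pi)" using measure_circ by (simp add: scaleR_conv_of_real)
    also have "(complex_of_real (2 * pi) + (LINT \<theta>|circ. \<phi>' \<theta>) - c * cnj (LINT \<theta>|circ. j \<theta>) - c * (LINT \<theta>|circ. \<phi> \<theta>))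
       = 2 * pi * (1 - c * cnj c)"
      unfolding phi(2) phi'(2) jint(2) c_def[symmetric] by (simp add: algebra_simps)
    also have "c * cnj c = of_real ((norm c)\<^sup>2)" by (rule complex_norm_square[symmetric])
    finally show ?thesis by simp
  qed
  have val: "norm (1 / (2 * of_real pi * \<i>) * contour_integral (circlepath 0 1)
            (\<lambda>\<zeta>. boundary_value g \<zeta> * cnj (K \<zeta>))) = (1 - (norm (J 0))\<^sup>2) powr (1 - 1 / q)"
    if K: "AE \<theta> in circ. ((\<lambda>r. J (of_real r * cis \<theta>)) \<longlongrightarrow> K (cis \<theta>)) (at_left 1)" for K
  proof -
    have "AE \<theta> in circ. boundary_value g (cis \<theta>) * cnj (K (cis \<theta>)) * cis \<theta> = y \<theta>"
      using K jlim j1 philim philim'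
    proof eventually_elim
      case (elim \<theta>)
      have Kj: "K (cis \<theta>) = j \<theta>" by (rule tendsto_unique[OF _ elim(1,2)]) simp
      have jj: "cnj (j \<theta>) * j \<theta> = 1" using elim(3) complex_norm_square[of "j \<theta>"] by (simp add: mult.commute)
      have "((\<lambda>r. J (of_real r * cis \<theta>) * \<psi> (J (of_real r * cis \<theta>))) \<longlongrightarrow> j \<theta> * \<phi> \<theta>) (at_left 1)"
        by (intro tendsto_mult elim)
      then have phij: "\<phi>' \<theta> = j \<theta> * \<phi> \<theta>" by (rule tendsto_unique[OF trivial_limit_at_left_real elim(5)])
      have ev: "\<forall>\<^sub>F r in at_left (1::real). (J (of_real r * cis \<theta>) - c) * (1 + J (of_real r * cis \<theta>) * \<psi> (J (of_real r * cis \<theta>))) / (of_real N * (of_real r * cis \<theta>))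
             = g (of_real r * cis \<theta>)"
      proof (rule eventually_at_leftI[of 0])
        fix r :: real assume r: "r \<in> {0<..<1}"
        let ?z = "of_real r * cis \<theta>"
        have nz: "norm ?z < 1" "?z \<noteq> 0" using r by (auto simp: norm_mult)
        have kk: "(1 - cnj c * J ?z) powr of_real \<beta> = (1 - cnj c * J ?z) powr of_real (2 / q) / (1 - cnj c * J ?z)"
          unfolding \<beta>_def of_real_diff of_real_1 using knz[OF J1[OF nz(1)]] by (simp add: powr_diff)
        have "h ?z = b ?z / ?z" using h(2)[OF nz(1)] nz(2) by simp
        then have "g ?z = (J ?z - c) * ((1 - cnj c * J ?z) powr of_real (2 / q) / (1 - cnj c * J ?z)) / (of_real N * ?z)"
          unfolding g_def b_def by (simp add: mult_ac)
        also have "\<dots> = (J ?z - c) * (1 + J ?z * \<psi> (J ?z)) / (of_real N * ?z)"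
          unfolding kk[symmetric] psi(3)[OF J1[OF nz(1)]] ..
        finally show "(J ?z - c) * (1 + J ?z * \<psi> (J ?z)) / (of_real N * ?z) = g ?z" by simp
      qed simp
      have "((\<lambda>r. (J (of_real r * cis \<theta>) - c) * (1 + J (of_real r * cis \<theta>) * \<psi> (J (of_real r * cis \<theta>))) / (of_real N * (of_real r * cis \<theta>)))
           \<longlongrightarrow> (j \<theta> - c) * (1 + j \<theta> * \<phi> \<theta>) / (of_real N * (of_real 1 * cis \<theta>))) (at_left 1)"
        by (intro tendsto_intros elim) (use N in auto)
      then have "((\<lambda>r. g (of_real r * cis \<theta>)) \<longlongrightarrow> (j \<theta> - c) * (1 + j \<theta> * \<phi> \<theta>) / (of_real N * (of_real 1 * cis \<theta>))) (at_left 1)"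
        using ev by (rule Lim_transform_eventually)
      note bv = boundary_value_eq[OF this]
      have "boundary_value g (cis \<theta>) * cnj (K (cis \<theta>)) * cis \<theta> = cnj (j \<theta>) * ((j \<theta> - c) * (1 + j \<theta> * \<phi> \<theta>)) / of_real N"
        unfolding Kj bv using N by simp
      also have "cnj (j \<theta>) * ((j \<theta> - c) * (1 + j \<theta> * \<phi> \<theta>)) =
          (cnj (j \<theta>) * j \<theta>) + (cnj (j \<theta>) * j \<theta>) * (j \<theta> * \<phi> \<theta>) - c * cnj (j \<theta>) - c * \<phi> \<theta> * (cnj (j \<theta>) * j \<theta>)"
        by (simp add: algebra_simps)
      finally show ?case unfolding y_def phij jj by simp
    qed
    from contour_integral_unit_circle_AE[OF this inty]
    have "norm (1 / (2 * of_real pi * \<i>) * contour_integral (circlepath 0 1) (\<lambda>\<zeta>. boundary_value g \<zeta> * cnj (K \<zeta>)))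
       = norm (complex_of_real ((1 - (norm c)\<^sup>2) / N))"
      unfolding vy by simp
    also have "\<dots> = (1 - (norm c)\<^sup>2) / N" using pos N by (simp only: norm_of_real) simp
    also have "\<dots> = (1 - (norm c)\<^sup>2) powr (1 - 1 / q)" using pos by (simp add: N_def powr_diff)
    finally show ?thesis by (simp only: c_def)
  qed
  show thesis by (rule that[OF gH gn val])
qed

section \<open>Strict monotonicity\<close>

text \<open>The second part identifies the radial limits of the product with the product of boundary values
that occurs in the pairing.\<close>

lemma inner_function_mult:
  assumes "inner_function J1" "inner_function J2"
  shows "inner_function (\<lambda>z. J1 z * J2 z)"
    and "AE \<theta> in circ. ((\<lambda>r. J1 (of_real r * cis \<theta>) * J2 (of_real r * cis \<theta>)) \<longlongrightarrow>
            boundary_value J1 (cis \<theta>) * boundary_value J2 (cis \<theta>)) (at_left 1)"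
proof -
  obtain j1 where hol1: "J1 holomorphic_on ball 0 1" and b1: "\<And>z. norm z < 1 \<Longrightarrow> norm (J1 z) \<le> 1"
    and lim1: "AE \<theta> in circ. ((\<lambda>r. J1 (of_real r * cis \<theta>)) \<longlongrightarrow> j1 \<theta>) (at_left 1)"
    and n1: "AE \<theta> in circ. norm (j1 \<theta>) = 1"
    using inner_boundary[OF assms(1)] by blast
  obtain j2 where hol2: "J2 holomorphic_on ball 0 1" and b2: "\<And>z. norm z < 1 \<Longrightarrow> norm (J2 z) \<le> 1"
    and lim2: "AE \<theta> in circ. ((\<lambda>r. J2 (of_real r * cis \<theta>)) \<longlongrightarrow> j2 \<theta>) (at_left 1)"
    and n2: "AE \<theta> in circ. norm (j2 \<theta>) = 1"
    using inner_boundary[OF assms(2)] by blast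
  have "norm (J1 z * J2 z) \<le> 1 * 1" if "norm z < 1" for z
    unfolding norm_mult using that b1 b2 by (intro mult_mono) auto
  then have "bounded ((\<lambda>z. J1 z * J2 z) ` ball 0 1)"
    by (auto simp: bounded_iff intro!: exI[of _ 1])
  moreover have "AE \<theta> in circ. norm (boundary_value (\<lambda>z. J1 z * J2 z) (cis \<theta>)) = 1"
    using lim1 lim2 n1 n2
  proof eventually_elim
    case (elim \<theta>)
    have "boundary_value (\<lambda>z. J1 z * J2 z) (cis \<theta>) = j1 \<theta> * j2 \<theta>"
      by (intro boundary_value_eq tendsto_mult elim)
    then show ?case using elim by (simp add: norm_mult)
  qed
  ultimately show "inner_function (\<lambda>z. J1 z * J2 z)"
    using hol1 hol2 by (auto simp: inner_function_def hardy_space_inf_def intro!: holomorphic_intros)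
  show "AE \<theta> in circ. ((\<lambda>r. J1 (of_real r * cis \<theta>) * J2 (of_real r * cis \<theta>)) \<longlongrightarrow>
            boundary_value J1 (cis \<theta>) * boundary_value J2 (cis \<theta>)) (at_left 1)"
    using lim1 lim2
  proof eventually_elim
    case (elim \<theta>)
    then show ?case unfolding boundary_value_eq[OF elim(1)] boundary_value_eq[OF elim(2)] by (rule tendsto_mult)
  qed
qed

theorem corollary3p7:
  fixes q :: real and J1 J2 :: "complex \<Rightarrow> complex"
  assumes "1 < q"
    and "inner_function J1" and "\<not> J1 constant_on ball 0 1" and "J1 0 \<noteq> 0"
    and "inner_function J2" and "\<not> J2 constant_on ball 0 1" and "J2 0 \<noteq> 0"
  shows
    "(SUP g\<in>{g \<in> hardy_space q. hardy_norm q g \<le> 1}.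
        ereal (norm (1 / (2 * of_real pi * \<i>) *
          contour_integral (circlepath 0 1)
            (\<lambda>\<zeta>. boundary_value g \<zeta> * cnj (boundary_value J1 \<zeta>)))))
     < (SUP g\<in>{g \<in> hardy_space q. hardy_norm q g \<le> 1}.
        ereal (norm (1 / (2 * of_real pi * \<i>) *
          contour_integral (circlepath 0 1)
            (\<lambda>\<zeta>. boundary_value g \<zeta> *
                   cnj (boundary_value J1 \<zeta> * boundary_value J2 \<zeta>)))))"
proof -
  let ?J = "\<lambda>z. J1 z * J2 z"
  let ?s = "1 - 1 / q"
  have lt1: "norm (J1 0) < 1"
    using inner_boundary[OF assms(2)] nonconstant_disc_map_less[OF _ _ assms(3), of 0] by (metis norm_zero zero_less_one)
  have lt2: "norm (J2 0) < 1"
    using inner_boundary[OF assms(5)] nonconstant_disc_map_less[OF _ _ assms(6), of 0] by (metis norm_zero zero_less_one)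
  have less: "norm (?J 0) < norm (J1 0)"
    using lt2 assms(4) by (simp add: norm_mult)
  have inner: "inner_function ?J" by (rule inner_function_mult(1)[OF assms(2,5)])
  have J0: "norm (?J 0) < 1" using less lt1 by linarith
  obtain g where g: "g \<in> hardy_space q" "hardy_norm q g \<le> 1"
    "\<And>K. AE \<theta> in circ. ((\<lambda>r. ?J (of_real r * cis \<theta>)) \<longlongrightarrow> K (cis \<theta>)) (at_left 1) \<Longrightarrow>
       norm (1 / (2 * of_real pi * \<i>) * contour_integral (circlepath 0 1)
            (\<lambda>\<zeta>. boundary_value g \<zeta> * cnj (K \<zeta>))) = (1 - (norm (?J 0))\<^sup>2) powr ?s"
    using pairing_attained[OF assms(1) inner J0] by blast
  note attained = g(3)[of "\<lambda>\<zeta>. boundary_value J1 \<zeta> * boundary_value J2 \<zeta>", OF inner_function_mult(2)[OF assms(2,5)]]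
  have "(SUP g\<in>{g \<in> hardy_space q. hardy_norm q g \<le> 1}.
        ereal (norm (1 / (2 * of_real pi * \<i>) *
          contour_integral (circlepath 0 1)
            (\<lambda>\<zeta>. boundary_value g \<zeta> * cnj (boundary_value J1 \<zeta>)))))
      \<le> ereal ((1 - (norm (J1 0))\<^sup>2) powr ?s)"
    by (intro SUP_least) (use pairing_upper_bound[OF assms(1,2) lt1] in \<open>simp only: mem_Collect_eq ereal_less_eq\<close>)
  also have "\<dots> < ereal ((1 - (norm (?J 0))\<^sup>2) powr ?s)"
  proof -
    have "(norm (?J 0))\<^sup>2 < (norm (J1 0))\<^sup>2" using less by (intro power_strict_mono) auto
    moreover have "0 \<le> 1 - (norm (J1 0))\<^sup>2" using lt1 by (simp add: abs_square_le_1)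
    ultimately have "(1 - (norm (J1 0))\<^sup>2) powr ?s < (1 - (norm (?J 0))\<^sup>2) powr ?s"
      using assms(1) by (intro powr_less_mono2) auto
    then show ?thesis by simp
  qed
  also have "\<dots> \<le> (SUP g\<in>{g \<in> hardy_space q. hardy_norm q g \<le> 1}.
        ereal (norm (1 / (2 * of_real pi * \<i>) *
          contour_integral (circlepath 0 1)
            (\<lambda>\<zeta>. boundary_value g \<zeta> *
                   cnj (boundary_value J1 \<zeta> * boundary_value J2 \<zeta>)))))"
    unfolding attained[symmetric] by (rule SUP_upper) (use g(1,2) in simp)
  finally show ?thesis .
qed

end
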